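(* Let $X$ be an infinite dimensional separable metrizable space and let $\alpha={\sf tp}_{{\sf S}_1(\mathcal{O}_{\sf fd},\mathcal{O})}(X)$. Then $\dim_G(X)\le \alpha$ if $\alpha$ is a limit ordinal, and $\dim_G(X)\le \alpha+\omega$ otherwise.
   Context: All spaces are separable metrizable. A space is finite dimensional if its Lebesgue covering dimension is finite, and infinite dimensional otherwise. For a space $X$, $\mathcal{O}$ denotes the collection of all open covers of $X$, and $\mathcal{O}_{\sf fd}$ denotes the collection of open covers $\mathcal{U}$ of $X$ such that for each finite dimensional subset $T\subseteq X$ there is $U\in\mathcal{U}$ with $T\subseteq U$ (the case $X\in\mathcal{U}$ is allowed). For an ordinal $\alpha$, the game ${\sf G}_1^{\alpha}(\mathcal{O}_{\sf fd},\mathcal{O})$ on $X$ has one inning per $\gamma<\alpha$: in inning $\gamma$ player ONE chooses $A_\gamma\in\mathcal{O}_{\sf fd}$ and TWO responds with $B_\gamma\in A_\gamma$. TWO wins the play if $\{B_\gamma:\gamma<\alpha\}$ is an open cover of $X$; otherwise ONE wins. ${\sf tp}_{{\sf S}_1(\mathcal{O}_{\sf fd},\mathcal{O})}(X)$ is the least ordinal $\alpha$ such that TWO has a winning strategy in this game on $X$. For an ordinal $\beta$, the game ${\sf G}_c^{\beta}(\mathcal{O},\mathcal{O})$ on $X$ has one inning per $\gamma<\beta$: in inning $\gamma$ ONE chooses an open cover $A_\gamma$ of $X$ and TWO responds with a pairwise disjoint family $B_\gamma$ of sets refining $A_\gamma$ (each member of $B_\gamma$ is contained in a member of $A_\gamma$).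 TWO wins the play if $\bigcup_{\gamma<\beta}B_\gamma$ is an open cover of $X$; otherwise ONE wins. ${\sf tp}_{{\sf S}_c(\mathcal{O},\mathcal{O})}(X)$ is the least $\beta$ such that TWO has a winning strategy in this game on $X$. The game dimension $\dim_G(X)$ is defined by $1+\dim_G(X)={\sf tp}_{{\sf S}_c(\mathcal{O},\mathcal{O})}(X)$ (so $\dim_G(\emptyset)=-1$). *)

theory Defs
  imports "HOL-Analysis.Analysis"
begin

unbundle cardinal_syntax
no_notation elt_set_eq (infix \<open>=o\<close> 50)

section \<open>Ordinals\<close>

text \<open>
  An ordinal is represented by a well-order relation, considered up to isomorphism; the comparison
  and the equality of ordinals are the library's \<^term>\<open>r \<le>o s\<close> and \<^term>\<open>r =o s\<close>, and
  \<^const>\<open>natLeq\<close> represents \<open>\<omega>\<close>.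
\<close>

definition ord_sum :: "'i rel \<Rightarrow> 'j rel \<Rightarrow> ('i + 'j) rel"  (infixr \<open>\<oplus>o\<close> 70) where
  "r \<oplus>o s = {(Inl a, Inl b) | a b. (a, b) \<in> r}
         \<union> {(Inr a, Inr b) | a b. (a, b) \<in> s}
         \<union> {(Inl a, Inr b) | a b. a \<in> Field r \<and> b \<in> Field s}"

definition ord_one :: "unit rel" where
  "ord_one = {((), ())}"

definition limit_ordinal :: "'i rel \<Rightarrow> bool" where
  "limit_ordinal r \<longleftrightarrow> Well_order r \<and> Field r \<noteq> {} \<and>
     (\<forall>a\<in>Field r. \<exists>b\<in>Field r. b \<noteq> a \<and> (a, b) \<in> r)"

definition least_ordinal :: "('i rel \<Rightarrow> bool) \<Rightarrow> 'i rel" where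
  "least_ordinal P =
     (SOME r. Well_order r \<and> P r \<and> (\<forall>s. Well_order s \<and> P s \<longrightarrow> r \<le>o s))"

section \<open>Covers and covering dimension\<close>

definition open_covers :: "'a topology \<Rightarrow> 'a set set set" where
  "open_covers X = {\<U>. (\<forall>U\<in>\<U>. openin X U) \<and> \<Union>\<U> = topspace X}"

definition refines :: "'a set set \<Rightarrow> 'a set set \<Rightarrow> bool" where
  "refines \<V> \<U> \<longleftrightarrow> (\<forall>V\<in>\<V>. \<exists>U\<in>\<U>. V \<subseteq> U)"

text \<open>
  Lebesgue covering dimension at most \<open>n\<close>, in the standard form with finite open covers; for metrizable
  spaces the form with arbitrary open covers is equivalent. The empty space, of dimension \<open>-1\<close>, has
  dimension at most \<open>0\<close> here.
\<close>

definition covering_dim_le :: "'a topology \<Rightarrow> nat \<Rightarrow> bool" where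
  "covering_dim_le X n \<longleftrightarrow>
     (\<forall>\<U>\<in>open_covers X. finite \<U> \<longrightarrow>
       (\<exists>\<V>\<in>open_covers X. finite \<V> \<and> refines \<V> \<U> \<and>
          (\<forall>x\<in>topspace X. card {V\<in>\<V>. x \<in> V} \<le> n + 1)))"

definition finite_dimensional :: "'a topology \<Rightarrow> bool" where
  "finite_dimensional X \<longleftrightarrow> (\<exists>n. covering_dim_le X n)"

definition fd_covers :: "'a topology \<Rightarrow> 'a set set set" where
  "fd_covers X = {\<U>\<in>open_covers X.
     \<forall>T\<subseteq>topspace X. finite_dimensional (subtopology X T) \<longrightarrow> (\<exists>U\<in>\<U>. T \<subseteq> U)}"

section \<open>Transfinite games\<close>

text \<open>
  The innings of a game are the elements of the field of the well-order \<open>r\<close>. In inning \<open>\<gamma>\<close>, ONE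
  chooses \<open>A \<gamma> \<in> M\<close> and TWO responds with an element of \<open>R (A \<gamma>)\<close>; TWO wins if the set of all of
  TWO's responses satisfies \<open>W\<close>. A strategy for TWO computes the response in inning \<open>\<gamma>\<close> from the moves
  of ONE in the innings up to and including \<open>\<gamma>\<close>.
\<close>

definition TWO_has_winning_strategy ::
    "'i rel \<Rightarrow> 'm set \<Rightarrow> ('m \<Rightarrow> 'n set) \<Rightarrow> ('n set \<Rightarrow> bool) \<Rightarrow> bool" where
  "TWO_has_winning_strategy r M R W \<longleftrightarrow>
     (\<exists>\<sigma>. \<forall>A. (\<forall>\<gamma>\<in>Field r. A \<gamma> \<in> M) \<longrightarrow>
        (\<forall>\<gamma>\<in>Field r. \<sigma> \<gamma> (restrict A (under r \<gamma>)) \<in> R (A \<gamma>)) \<and>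
        W ((\<lambda>\<gamma>. \<sigma> \<gamma> (restrict A (under r \<gamma>))) ` Field r))"

definition TWO_wins_S1_fd :: "'a topology \<Rightarrow> 'i rel \<Rightarrow> bool" where
  "TWO_wins_S1_fd X r \<longleftrightarrow>
     TWO_has_winning_strategy r (fd_covers X) (\<lambda>\<A>. \<A>) (\<lambda>\<B>. \<B> \<in> open_covers X)"

definition TWO_wins_Sc :: "'a topology \<Rightarrow> 'i rel \<Rightarrow> bool" where
  "TWO_wins_Sc X r \<longleftrightarrow>
     TWO_has_winning_strategy r (open_covers X)
       (\<lambda>\<A>. {\<B>. pairwise disjnt \<B> \<and> refines \<B> \<A>}) (\<lambda>\<BB>. \<Union>\<BB> \<in> open_covers X)"

text \<open>
  Well-orders on the type of points suffice as lengths: the facts below show that a least length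
  exists among them, and that it is least among the well-orders on an arbitrary type.
\<close>

definition tp_S1_fd :: "'a topology \<Rightarrow> 'a rel" where
  "tp_S1_fd X = least_ordinal (TWO_wins_S1_fd X)"

definition tp_Sc :: "'a topology \<Rightarrow> 'a rel" where
  "tp_Sc X = least_ordinal (TWO_wins_Sc X)"

text \<open>
  For the empty space the value would be \<open>-1\<close>, which is not an ordinal; \<open>dim_G\<close> is meaningful
  for nonempty spaces only.
\<close>

definition dim_G :: "'a topology \<Rightarrow> 'a rel" where
  "dim_G X = (SOME d. Well_order d \<and> ord_one \<oplus>o d =o tp_Sc X)"

section \<open>Well-definedness of the invariants\<close>

lemma TWO_has_winning_strategy_ordIso:
  fixes r :: "'i rel" and s :: "'j rel"
  assumes "r =o s" and "TWO_has_winning_strategy r M R W"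
  shows "TWO_has_winning_strategy s M R W"
proof -
  obtain f where f: "iso r s f" and wr: "Well_order r"
    using assms(1) unfolding ordIso_def by auto
  have bij: "bij_betw f (Field r) (Field s)"
    and und: "\<And>a. a \<in> Field r \<Longrightarrow> bij_betw f (under r a) (under s (f a))"
    using f unfolding iso_def embed_def by auto
  obtain \<sigma> where \<sigma>: "\<And>A. (\<forall>\<gamma>\<in>Field r. A \<gamma> \<in> M) \<Longrightarrow>
        (\<forall>\<gamma>\<in>Field r. \<sigma> \<gamma> (restrict A (under r \<gamma>)) \<in> R (A \<gamma>)) \<and>
        W ((\<lambda>\<gamma>. \<sigma> \<gamma> (restrict A (under r \<gamma>))) ` Field r)"
    using assms(2) unfolding TWO_has_winning_strategy_def by blast
  define g where "g = inv_into (Field r) f"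
  define \<tau> where "\<tau> = (\<lambda>\<gamma> H. \<sigma> (g \<gamma>) (restrict (\<lambda>b. H (f b)) (under r (g \<gamma>))))"
  have gf: "g (f a) = a" if "a \<in> Field r" for a
    using bij that unfolding g_def by (simp add: bij_betw_def)
  have FS: "Field s = f ` Field r" using bij by (simp add: bij_betw_def)
  have eq: "\<tau> (f a) (restrict A (under s (f a))) = \<sigma> a (restrict (\<lambda>b. A (f b)) (under r a))"
    if "a \<in> Field r" for a A
  proof -
    have "f b \<in> under s (f a)" if "b \<in> under r a" for b
      using und[OF \<open>a \<in> Field r\<close>] that by (auto simp: bij_betw_def)
    then have "restrict (\<lambda>b. restrict A (under s (f a)) (f b)) (under r a)
                 = restrict (\<lambda>b. A (f b)) (under r a)"
      by (auto simp: restrict_def fun_eq_iff)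
    then show ?thesis unfolding \<tau>_def gf[OF that] by simp
  qed
  show ?thesis unfolding TWO_has_winning_strategy_def
  proof (intro exI[of _ \<tau>] allI impI)
    fix A assume A: "\<forall>\<gamma>\<in>Field s. A \<gamma> \<in> M"
    have A': "\<forall>\<gamma>\<in>Field r. A (f \<gamma>) \<in> M" using A FS by auto
    have im: "(\<lambda>\<gamma>. \<tau> \<gamma> (restrict A (under s \<gamma>))) ` Field s
        = (\<lambda>a. \<sigma> a (restrict (\<lambda>b. A (f b)) (under r a))) ` Field r"
      unfolding FS image_image by (rule image_cong) (simp_all add: eq)
    show "(\<forall>\<gamma>\<in>Field s. \<tau> \<gamma> (restrict A (under s \<gamma>)) \<in> R (A \<gamma>)) \<and>
        W ((\<lambda>\<gamma>. \<tau> \<gamma> (restrict A (under s \<gamma>))) ` Field s)"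
      unfolding im using \<sigma>[OF A'] unfolding FS by (auto simp: eq)
  qed
qed

lemma least_ordinal_works:
  assumes "Well_order r" "P r"
  shows "Well_order (least_ordinal P)" "P (least_ordinal P)"
    and "\<And>s. Well_order s \<Longrightarrow> P s \<Longrightarrow> least_ordinal P \<le>o s"
proof -
  have "\<exists>m\<in>{r. Well_order r \<and> P r}. \<forall>s\<in>{r. Well_order r \<and> P r}. m \<le>o s"
    by (rule exists_minim_Well_order) (use assms in auto)
  then have "\<exists>r. Well_order r \<and> P r \<and> (\<forall>s. Well_order s \<and> P s \<longrightarrow> r \<le>o s)"
    by auto
  from someI_ex[OF this]
  show "Well_order (least_ordinal P)" "P (least_ordinal P)"
    "\<And>s. Well_order s \<Longrightarrow> P s \<Longrightarrow> least_ordinal P \<le>o s"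
    unfolding least_ordinal_def by auto
qed

lemma least_game_length:
  fixes s :: "'j rel" and r :: "'i rel" and M :: "'m set" and R :: "'m \<Rightarrow> 'n set" and W
  defines "P \<equiv> \<lambda>r::'i rel. TWO_has_winning_strategy r M R W"
  assumes r: "Well_order r" "P r"
    and s: "Well_order s" "TWO_has_winning_strategy s M R W"
  shows "least_ordinal P \<le>o s"
proof (rule ccontr)
  assume "\<not> least_ordinal P \<le>o s"
  then have "s <o least_ordinal P"
    using not_ordLeq_iff_ordLess least_ordinal_works(1)[of r P] r s(1) by blast
  then obtain a where "s =o Restr (least_ordinal P) (underS (least_ordinal P) a)"
    using ordLess_iff_ordIso_Restr least_ordinal_works(1)[of r P] r s(1) by blast
  then obtain t :: "'i rel" where t: "s =o t" by blast
  then have wt: "Well_order t" unfolding ordIso_def by auto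
  have "P t" using TWO_has_winning_strategy_ordIso[OF t s(2)] by (simp add: P_def)
  then have "least_ordinal P \<le>o t"
    using least_ordinal_works(3)[of r P] r wt by blast
  also have "t =o s" using t by (rule ordIso_symmetric)
  finally show False using \<open>\<not> least_ordinal P \<le>o s\<close> by simp
qed

lemma exists_winning_length:
  fixes X :: "'a topology"
  obtains r :: "'a rel" where "Well_order r" "TWO_wins_S1_fd X r" "TWO_wins_Sc X r"
proof -
  obtain r where r: "well_order_on (topspace X) r" using well_order_on by blast
  then have F: "Field r = topspace X" and wr: "Well_order r"
    using well_order_on_Well_order by blast+
  have un: "x \<in> under r x" if "x \<in> topspace X" for x
    using wr F that unfolding well_order_on_def linear_order_on_def partial_order_on_def
      preorder_on_def refl_on_def under_def by auto
  define pick where "pick = (\<lambda>x \<A>. SOME U. U \<in> \<A> \<and> (x::'a) \<in> U)"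
  have pick: "pick x \<A> \<in> \<A> \<and> x \<in> pick x \<A>" if "x \<in> topspace X" "\<A> \<in> open_covers X" for x \<A>
  proof -
    have "\<exists>U. U \<in> \<A> \<and> x \<in> U" using that unfolding open_covers_def by auto
    from someI_ex[OF this] show ?thesis unfolding pick_def .
  qed
  have cov: "(\<lambda>x. pick x (A x)) ` topspace X \<in> open_covers X"
    if A: "\<forall>x\<in>topspace X. A x \<in> open_covers X" for A
  proof -
    have op: "openin X (pick x (A x))" if "x \<in> topspace X" for x
      using pick[OF that bspec[OF A that]] bspec[OF A that] by (simp add: open_covers_def)
    moreover have "x \<in> pick x (A x)" if "x \<in> topspace X" for x
      using pick[OF that bspec[OF A that]] by blast
    ultimately have "(\<Union>x\<in>topspace X. pick x (A x)) = topspace X"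
      by (blast dest: openin_subset)
    with op show ?thesis unfolding open_covers_def by auto
  qed
  have sub: "fd_covers X \<subseteq> open_covers X" unfolding fd_covers_def by auto
  have "TWO_wins_S1_fd X r"
    unfolding TWO_wins_S1_fd_def TWO_has_winning_strategy_def F
  proof (intro exI[of _ "\<lambda>x H. pick x (H x)"] allI impI)
    fix A assume "\<forall>\<gamma>\<in>topspace X. A \<gamma> \<in> fd_covers X"
    then have A: "\<forall>\<gamma>\<in>topspace X. A \<gamma> \<in> open_covers X" using sub by auto
    have im: "(\<lambda>\<gamma>. pick \<gamma> (restrict A (under r \<gamma>) \<gamma>)) ` topspace X
        = (\<lambda>x. pick x (A x)) ` topspace X"
      by (rule image_cong) (simp_all add: un)
    show "(\<forall>\<gamma>\<in>topspace X. pick \<gamma> (restrict A (under r \<gamma>) \<gamma>) \<in> A \<gamma>) \<and>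
      (\<lambda>\<gamma>. pick \<gamma> (restrict A (under r \<gamma>) \<gamma>)) ` topspace X \<in> open_covers X"
      unfolding im using cov[OF A] pick A un by auto
  qed
  moreover have "TWO_wins_Sc X r"
    unfolding TWO_wins_Sc_def TWO_has_winning_strategy_def F
  proof (intro exI[of _ "\<lambda>x H. {pick x (H x)}"] allI impI)
    fix A assume A: "\<forall>\<gamma>\<in>topspace X. A \<gamma> \<in> open_covers X"
    have im: "\<Union> ((\<lambda>\<gamma>. {pick \<gamma> (restrict A (under r \<gamma>) \<gamma>)}) ` topspace X)
        = (\<lambda>x. pick x (A x)) ` topspace X"
      using un by auto
    show "(\<forall>\<gamma>\<in>topspace X. {pick \<gamma> (restrict A (under r \<gamma>) \<gamma>)}
          \<in> {\<B>. pairwise disjnt \<B> \<and> refines \<B> (A \<gamma>)}) \<and>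
      \<Union> ((\<lambda>\<gamma>. {pick \<gamma> (restrict A (under r \<gamma>) \<gamma>)}) ` topspace X) \<in> open_covers X"
      unfolding im using cov[OF A] pick A un by (auto simp: refines_def)
  qed
  ultimately show ?thesis using that wr by blast
qed

lemma tp_S1_fd_works:
  shows "Well_order (tp_S1_fd X)" "TWO_wins_S1_fd X (tp_S1_fd X)"
    and "\<And>s :: 'i rel. Well_order s \<Longrightarrow> TWO_wins_S1_fd X s \<Longrightarrow> tp_S1_fd X \<le>o s"
proof -
  obtain r :: "'a rel" where r: "Well_order r" "TWO_wins_S1_fd X r"
    by (rule exists_winning_length)
  show "Well_order (tp_S1_fd X)" "TWO_wins_S1_fd X (tp_S1_fd X)"
    unfolding tp_S1_fd_def using least_ordinal_works[of r "TWO_wins_S1_fd X"] r by auto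
  show "tp_S1_fd X \<le>o s" if "Well_order s" "TWO_wins_S1_fd X s" for s :: "'i rel"
    unfolding tp_S1_fd_def TWO_wins_S1_fd_def
    by (rule least_game_length[OF r[unfolded TWO_wins_S1_fd_def] that[unfolded TWO_wins_S1_fd_def]])
qed

lemma tp_Sc_works:
  shows "Well_order (tp_Sc X)" "TWO_wins_Sc X (tp_Sc X)"
    and "\<And>s :: 'i rel. Well_order s \<Longrightarrow> TWO_wins_Sc X s \<Longrightarrow> tp_Sc X \<le>o s"
proof -
  obtain r :: "'a rel" where r: "Well_order r" "TWO_wins_Sc X r"
    by (rule exists_winning_length)
  show "Well_order (tp_Sc X)" "TWO_wins_Sc X (tp_Sc X)"
    unfolding tp_Sc_def using least_ordinal_works[of r "TWO_wins_Sc X"] r by auto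
  show "tp_Sc X \<le>o s" if "Well_order s" "TWO_wins_Sc X s" for s :: "'i rel"
    unfolding tp_Sc_def TWO_wins_Sc_def
    by (rule least_game_length[OF r[unfolded TWO_wins_Sc_def] that[unfolded TWO_wins_Sc_def]])
qed

lemma dim_G_works:
  assumes "topspace X \<noteq> {}"
  shows "Well_order (dim_G X)" "ord_one \<oplus>o dim_G X =o tp_Sc X"
proof -
  define t where "t = tp_Sc X"
  have wt: "Well_order t" and win: "TWO_wins_Sc X t"
    using tp_Sc_works(1,2) unfolding t_def by blast+
  interpret wo_rel t using wt by (simp add: wo_rel_def)
  have "Field t \<noteq> {}"
  proof
    assume "Field t = {}"
    with win have "{} \<in> open_covers X"
      unfolding TWO_wins_Sc_def TWO_has_winning_strategy_def by simp
    then have "topspace X = {}" by (auto simp: open_covers_def)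
    with assms show False by blast
  qed
  then obtain z where z: "z \<in> Field t" "\<And>b. b \<in> Field t \<Longrightarrow> (z, b) \<in> t"
    using minim_in[of "Field t"] minim_least[of "Field t"] by blast
  define d where "d = Restr t (Field t - {z})"
  define f where "f = (\<lambda>x. if x = z then Inl () else Inr x)"
  have wd: "Well_order d" unfolding d_def by (rule Well_order_Restr[OF wt])
  have Fd: "Field d = Field t - {z}"
    unfolding d_def by (rule Refl_Field_Restr2[OF REFL]) auto
  have nz: "(b, z) \<notin> t" if "b \<noteq> z" for b
    using that z antisymD[OF ANTISYM, of b z] FieldI1[of b z t] by blast
  have tF: "(a, b) \<in> t \<Longrightarrow> a \<in> Field t \<and> b \<in> Field t" for a b
    by (auto simp: Field_def)
  have "ord_one \<oplus>o d = dir_image t f"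
  proof (rule set_eqI)
    fix pq
    show "pq \<in> ord_one \<oplus>o d \<longleftrightarrow> pq \<in> dir_image t f"
    proof
      assume "pq \<in> ord_one \<oplus>o d"
      then consider "pq = (Inl (), Inl ())"
        | a b where "pq = (Inr a, Inr b)" "(a, b) \<in> d"
        | b where "pq = (Inl (), Inr b)" "b \<in> Field d"
        unfolding ord_sum_def ord_one_def by auto
      then show "pq \<in> dir_image t f"
      proof cases
        case 1
        then have "pq = (f z, f z)" by (simp add: f_def)
        then show ?thesis using z unfolding dir_image_def by blast
      next
        case (2 a b)
        then have "pq = (f a, f b)" "(a, b) \<in> t" by (auto simp: f_def d_def)
        then show ?thesis unfolding dir_image_def by blast
      next
        case (3 b)
        then have "pq = (f z, f b)" "b \<in> Field t" unfolding Fd by (auto simp: f_def)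
        then show ?thesis using z unfolding dir_image_def by blast
      qed
    next
      assume "pq \<in> dir_image t f"
      then obtain a b where ab: "pq = (f a, f b)" "(a, b) \<in> t"
        unfolding dir_image_def by blast
      show "pq \<in> ord_one \<oplus>o d"
        using ab nz[of a] tF[OF ab(2)]
        by (cases "a = z"; cases "b = z")
          (simp_all add: ord_sum_def ord_one_def f_def Fd, simp add: d_def)
    qed
  qed
  moreover have "inj_on f (Field t)" by (auto simp: inj_on_def f_def)
  ultimately have "t =o ord_one \<oplus>o d" using dir_image_ordIso[OF wt] by metis
  then have "\<exists>d :: 'a rel. Well_order d \<and> ord_one \<oplus>o d =o tp_Sc X"
    using wd ordIso_symmetric unfolding t_def by blast
  from someI_ex[OF this] show "Well_order (dim_G X)" "ord_one \<oplus>o dim_G X =o tp_Sc X"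
    unfolding dim_G_def by auto
qed

end

theory Submission
  imports Defs
begin

text \<open>
  If \<open>\<sigma>\<close> wins \<open>G\<^sub>1(O\<^sub>f\<^sub>d, O)\<close> for TWO, then at every position there is a finite dimensional set
  \<open>T\<close> such that every open \<open>U \<supseteq> T\<close> is the answer of \<open>\<sigma>\<close> to some cover: otherwise choose for each \<open>T\<close> an
  open \<open>U\<^sub>T \<supseteq> T\<close> that is not an answer and let ONE play \<open>{U\<^sub>T}\<close>. Since \<open>T\<close> is a finite union of
  zero dimensional sets, TWO can cover \<open>T\<close> in finitely many innings of \<open>G\<^sub>c(O, O)\<close>; the union of these
  answers is an open \<open>U \<supseteq> T\<close>, and thus one inning of a simulated play against \<open>\<sigma>\<close>. Replacing every
  inning by finitely many does not lengthen a limit ordinal; when \<open>\<alpha>\<close> is not a limit, one first passes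
  to \<open>\<alpha> + \<omega>\<close>.
\<close>

section \<open>Decomposition of finite dimensional spaces\<close>

text \<open>The simulated game wants covers in \<open>fd_covers X\<close>, but ONE's actual moves
  are arbitrary open covers. The way out is timing: \<open>T\<close> depends only on the simulated
  moves before the current one, so TWO can cover \<open>T\<close> out of ONE's actual covers and
  choose the simulated cover in hindsight, as one that \<sigma> answers by exactly the open set thus
  produced. No uniform bound exists for the number of innings this takes, as \<open>T\<close> may
  have any finite dimension and varies with the history; hence the blocks of innings have variable
  finite length.

  Covering dimension is defined here by finite open covers, whereas ONE plays arbitrary ones. A
  countable family of separated closed pairs, supplied by a countable base, bridges the gap:
  partitioning finitely many pairs at a time calls for finite covers only, and an arbitrary cover is
  handled once all pairs are partitioned. The pieces are found inside the subspace \<open>T\<close>,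
  yet TWO's families must be open and disjoint in \<open>X\<close>; the metric permits this
  enlargement.\<close>

lemma metrizable_openin_eq_positive:
  assumes "metrizable_space X" "openin X W"
  obtains f where "continuous_map X euclideanreal f" "\<And>x. 0 \<le> f x"
    "\<And>x. x \<in> topspace X \<Longrightarrow> 0 < f x \<longleftrightarrow> x \<in> W"
proof -
  obtain M d where "Metric_space M d" and X: "X = Metric_space.mtopology M d"
    using assms(1) unfolding metrizable_space_def by blast
  then interpret Metric_space M d by simp
  define K where "K = M - W"
  have WM: "W \<subseteq> M" using assms(2) openin_subset[of X W] by (simp add: X)
  show ?thesis
  \<comment> \<open>The distance to an empty complement would be an infimum over the empty set; the
    constant 1 takes its place.\<close>
  proof (cases "K = {}")
    case True
    show ?thesis
      by (rule that[of "\<lambda>x. 1"]) (use True WM in \<open>auto simp: K_def X\<close>)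
  next
    case False
    define f where "f = (\<lambda>x. Inf (d x ` K))"
    have bdd: "bdd_below (d x ` K)" for x
      by (rule bdd_belowI[of _ 0]) auto
    have nonneg: "0 \<le> f x" for x
      unfolding f_def using False by (intro cINF_greatest) auto
    have half: "f x \<le> f y + d x y" if "x \<in> M" "y \<in> M" for x y
    proof -
      have "f x - d x y \<le> d y z" if z: "z \<in> K" for z
      proof -
        have "f x \<le> d x z" unfolding f_def by (rule cINF_lower[OF bdd z])
        also have "\<dots> \<le> d x y + d y z"
          using z \<open>x \<in> M\<close> \<open>y \<in> M\<close> by (intro triangle) (auto simp: K_def)
        finally show ?thesis by simp
      qed
      then have "f x - d x y \<le> f y"
        unfolding f_def using False by (intro cINF_greatest) (auto simp: f_def)
      then show ?thesis by simp
    qed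
    have lip: "\<bar>f x - f y\<bar> \<le> d x y" if "x \<in> M" "y \<in> M" for x y
      using half[OF that] half[OF that(2,1)] commute[of x y] by linarith
    have cont: "continuous_map X euclideanreal f"
    proof -
      have "Lipschitz_continuous_map (metric (M,d)) euclidean_metric f"
        unfolding Lipschitz_continuous_map_def
        by (auto intro!: exI[of _ 1] simp: lip dist_real_def)
      then show ?thesis
        using Lipschitz_continuous_imp_continuous_map X mtopology_of by fastforce
    qed
    have pos: "0 < f x \<longleftrightarrow> x \<in> W" if "x \<in> M" for x
    proof
      assume "x \<in> W"
      then obtain r where r: "r > 0" "mball x r \<subseteq> W"
        using assms(2) unfolding X openin_mtopology by blast
      have "r \<le> d x z" if "z \<in> K" for z
        using r that \<open>x \<in> M\<close> unfolding K_def by (force simp: mball_def)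
      then have "r \<le> f x" unfolding f_def using False by (intro cINF_greatest) auto
      with r show "0 < f x" by simp
    next
      assume "0 < f x"
      show "x \<in> W"
      proof (rule ccontr)
        assume "x \<notin> W"
        then have "x \<in> K" using that by (simp add: K_def)
        then have "f x \<le> d x x" unfolding f_def by (rule cINF_lower[OF bdd])
        with \<open>0 < f x\<close> that show False by simp
      qed
    qed
    show ?thesis by (rule that[OF cont nonneg]) (use pos X in simp)
  qed
qed

lemma continuous_map_Max:
  assumes "finite I" "I \<noteq> {}" "\<And>i. i \<in> I \<Longrightarrow> continuous_map X euclideanreal (f i)"
  shows "continuous_map X euclideanreal (\<lambda>x. Max ((\<lambda>i. f i x) ` I))"
  using assms
proof (induction I rule: finite_ne_induct)
  case (insert i I)
  then have "(\<lambda>x. Max ((\<lambda>i. f i x) ` insert i I)) = (\<lambda>x. max (f i x) (Max ((\<lambda>i. f i x) ` I)))"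
    by (auto simp: fun_eq_iff)
  with insert show ?case by (auto intro!: continuous_map_real_max)
qed simp

text \<open>
  For a finite open cover \<open>\<W>\<close> of order at most \<open>n + 1\<close> put \<open>h\<^sub>w = e\<^sub>w / max\<^sub>v e\<^sub>v\<close>, where \<open>e\<^sub>w\<close> vanishes
  exactly off \<open>w\<close>, and let \<open>m\<^sub>j\<close> be the maximum of the \<open>h\<^sub>w\<close> with \<open>w\<close> meeting \<open>C\<^sub>j\<close>. At a point at most
  \<open>n + 1\<close> of the \<open>h\<^sub>w\<close> are nonzero and one of them is 1, so at most \<open>n\<close> values lie strictly between.
\<close>

lemma covering_dim_le_Urysohn_functions:
  fixes C D :: "'j \<Rightarrow> 'a set"
  assumes "metrizable_space Y" and dim: "covering_dim_le Y n" and "finite J"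
    and closed: "\<And>j. j \<in> J \<Longrightarrow> closedin Y (C j) \<and> closedin Y (D j) \<and> disjnt (C j) (D j)"
  obtains m :: "'j \<Rightarrow> 'a \<Rightarrow> real"
  where "\<And>j. j \<in> J \<Longrightarrow> continuous_map Y euclideanreal (m j)"
    "\<And>j x. j \<in> J \<Longrightarrow> x \<in> C j \<Longrightarrow> m j x = 1"
    "\<And>j x. j \<in> J \<Longrightarrow> x \<in> D j \<Longrightarrow> m j x = 0"
    "\<And>x. x \<in> topspace Y \<Longrightarrow> card ((\<lambda>j. m j x) ` J - {0, 1}) \<le> n"
proof -
  \<comment> \<open>A set inside some \<open>A S\<close> misses \<open>C j\<close> or
    \<open>D j\<close> according to whether \<open>j\<close> is in \<open>S\<close>. Refining the
    cover indexed by the subsets of \<open>J\<close> therefore forces \<open>avoid\<close>, and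
    finiteness of \<open>J\<close> makes that cover finite.\<close>
  define A where "A = (\<lambda>S. topspace Y - (\<Union>j\<in>J. if j \<in> S then C j else D j))"
  have Aop: "openin Y (A S)" for S
    unfolding A_def using closed \<open>finite J\<close>
    by (intro openin_diff openin_topspace closedin_Union) (auto split: if_splits)
  have "topspace Y \<subseteq> \<Union>(A ` Pow J)"
  proof
    fix x assume "x \<in> topspace Y"
    then have "x \<in> A {j\<in>J. x \<notin> C j}"
      using closed by (auto simp: A_def disjnt_iff split: if_splits)
    then show "x \<in> \<Union>(A ` Pow J)" by (intro UN_I[of "{j\<in>J. x \<notin> C j}"]) auto
  qed
  then have cov: "A ` Pow J \<in> open_covers Y"
    using Aop unfolding open_covers_def by (auto simp: A_def)
  have "finite (A ` Pow J)" using \<open>finite J\<close> by simp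
  with bspec[OF dim[unfolded covering_dim_le_def] cov]
  obtain \<W> where \<W>: "\<W> \<in> open_covers Y" "finite \<W>" "refines \<W> (A ` Pow J)"
    and ord: "\<And>x. x \<in> topspace Y \<Longrightarrow> card {V\<in>\<W>. x \<in> V} \<le> n + 1"
    by (elim impE bexE conjE) auto
  have avoid: "disjnt w (C j) \<or> disjnt w (D j)" if w: "w \<in> \<W>" and j: "j \<in> J" for w j
  proof -
    obtain S where "w \<subseteq> A S" using \<W>(3) w unfolding refines_def by blast
    then show ?thesis using j by (cases "j \<in> S") (auto simp: A_def disjnt_iff)
  qed
  have "\<exists>f. continuous_map Y euclideanreal f \<and> (\<forall>x. 0 \<le> f x) \<and>
      (\<forall>x\<in>topspace Y. 0 < f x \<longleftrightarrow> x \<in> w)" if "w \<in> \<W>" for w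
    using metrizable_openin_eq_positive[OF assms(1), of w] \<W>(1) that unfolding open_covers_def
    by (metis (no_types, lifting) mem_Collect_eq)
  then obtain e :: "'a set \<Rightarrow> 'a \<Rightarrow> real" where econt: "\<And>w. w \<in> \<W> \<Longrightarrow> continuous_map Y euclideanreal (e w)"
    and enn: "\<And>w x. w \<in> \<W> \<Longrightarrow> 0 \<le> e w x"
    and epos: "\<And>w x. w \<in> \<W> \<Longrightarrow> x \<in> topspace Y \<Longrightarrow> 0 < e w x \<longleftrightarrow> x \<in> w"
    by metis
  \<comment> \<open>The inserted 0 serves the degenerate case of an empty \<open>\<W>\<close>, where
    \<open>Max\<close> would be taken over nothing. In \<open>m\<close> below it serves those
    \<open>j\<close> for which no member of \<open>\<W>\<close> meets \<open>C j\<close>.\<close>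
  define g where "g = (\<lambda>x. Max (insert 0 ((\<lambda>w. e w x) ` \<W>)))"
  define h where "h = (\<lambda>w x. e w x / g x)"
  have top: "\<exists>w\<in>\<W>. x \<in> w \<and> e w x = g x \<and> 0 < g x" if x: "x \<in> topspace Y" for x
  proof -
    obtain v where v: "v \<in> \<W>" "x \<in> v" using \<W>(1) x unfolding open_covers_def by blast
    then have "0 < e v x" using epos x by simp
    also have "e v x \<le> g x" unfolding g_def using v \<W>(2) by (intro Max_ge) auto
    finally have g0: "0 < g x" .
    have "g x \<in> insert 0 ((\<lambda>w. e w x) ` \<W>)"
      unfolding g_def using \<W>(2) by (intro Max_in) auto
    with g0 obtain w where w: "w \<in> \<W>" "e w x = g x" by auto
    then have "x \<in> w" using epos[OF w(1) x] g0 by simp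
    with w g0 show ?thesis by blast
  qed
  have le_g: "e w x \<le> g x" if "w \<in> \<W>" for w x
    unfolding g_def using that \<W>(2) by (intro Max_ge) auto
  have gcont: "continuous_map Y euclideanreal g"
  proof (cases "\<W> = {}")
    case True then show ?thesis by (simp add: g_def)
  next
    case False
    then have "g = (\<lambda>x. max 0 (Max ((\<lambda>w. e w x) ` \<W>)))"
      using \<W>(2) by (auto simp: g_def fun_eq_iff)
    then show ?thesis
      using continuous_map_Max[OF \<W>(2) False econt]
      by (auto intro!: continuous_map_real_max)
  qed
  have hcont: "continuous_map Y euclideanreal (h w)" if "w \<in> \<W>" for w
    unfolding h_def using continuous_map_real_divide[OF econt[OF that] gcont] top
    by (metis less_irrefl)
  have h01: "0 \<le> h w x" "h w x \<le> 1" if "w \<in> \<W>" "x \<in> topspace Y" for w x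
    using enn[OF that(1), of x] le_g[OF that(1), of x] top[OF that(2)] by (auto simp: h_def)
  define \<W>j where "\<W>j = (\<lambda>j. {w\<in>\<W>. \<not> disjnt w (C j)})"
  define m where "m = (\<lambda>j x. Max (insert 0 ((\<lambda>w. h w x) ` \<W>j j)))"
  have fin: "finite (\<W>j j)" for j using \<W>(2) by (simp add: \<W>j_def)
  have m_cases: "m j x = 0 \<or> (\<exists>w\<in>\<W>j j. m j x = h w x)" for j x
  proof -
    have "m j x \<in> insert 0 ((\<lambda>w. h w x) ` \<W>j j)"
      unfolding m_def using fin by (intro Max_in) auto
    then show ?thesis by auto
  qed
  show ?thesis
  proof (rule that[of m])
    fix j assume "j \<in> J"
    show "continuous_map Y euclideanreal (m j)"
    proof (cases "\<W>j j = {}")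
      case True then show ?thesis by (simp add: m_def)
    next
      case False
      then have "m j = (\<lambda>x. max 0 (Max ((\<lambda>w. h w x) ` \<W>j j)))"
        using fin by (auto simp: m_def fun_eq_iff)
      moreover have "continuous_map Y euclideanreal (\<lambda>x. Max ((\<lambda>w. h w x) ` \<W>j j))"
        by (rule continuous_map_Max[OF fin False]) (auto simp: \<W>j_def hcont)
      ultimately show ?thesis by (auto intro!: continuous_map_real_max)
    qed
  next
    fix j x assume j: "j \<in> J" and x: "x \<in> C j"
    then have xY: "x \<in> topspace Y" using closed closedin_subset by blast
    obtain w where w: "w \<in> \<W>" "x \<in> w" "e w x = g x" "0 < g x" using top[OF xY] by blast
    then have "w \<in> \<W>j j" "h w x = 1" using x by (auto simp: \<W>j_def h_def disjnt_iff)
    then have "1 \<le> m j x" unfolding m_def using fin by (intro Max_ge) (auto intro!: image_eqI[of _ _ w])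
    moreover have "m j x \<le> 1" using m_cases[of j x] h01 xY by (auto simp: \<W>j_def)
    ultimately show "m j x = 1" by simp
  next
    fix j x assume j: "j \<in> J" and x: "x \<in> D j"
    then have xY: "x \<in> topspace Y" using closed closedin_subset by blast
    have "h w x = 0" if "w \<in> \<W>j j" for w
    proof -
      have w: "w \<in> \<W>" "\<not> disjnt w (C j)" using that by (auto simp: \<W>j_def)
      then have "x \<notin> w" using avoid[OF w(1) j] x by (auto simp: disjnt_iff)
      then have "e w x = 0" using epos[OF w(1) xY] enn[OF w(1), of x] by simp
      then show ?thesis by (simp add: h_def)
    qed
    then show "m j x = 0" using m_cases[of j x] by auto
  next
    fix x assume x: "x \<in> topspace Y"
    obtain w0 where w0: "w0 \<in> \<W>" "x \<in> w0" "e w0 x = g x" "0 < g x" using top[OF x] by blast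
    let ?N = "{w\<in>\<W>. x \<in> w}"
    have "(\<lambda>j. m j x) ` J - {0, 1} \<subseteq> (\<lambda>w. h w x) ` (?N - {w0})"
    proof
      fix y assume y: "y \<in> (\<lambda>j. m j x) ` J - {0, 1}"
      then obtain j where j: "y = m j x" "m j x \<noteq> 0" "m j x \<noteq> 1" by auto
      then obtain w where w: "w \<in> \<W>" "m j x = h w x" using m_cases[of j x] by (auto simp: \<W>j_def)
      then have "e w x \<noteq> 0" using j by (auto simp: h_def)
      then have "x \<in> w" using epos[OF w(1) x] enn[OF w(1), of x] by simp
      moreover have "w \<noteq> w0" using j w w0 by (auto simp: h_def)
      ultimately show "y \<in> (\<lambda>w. h w x) ` (?N - {w0})" using w j by auto
    qed
    then have "card ((\<lambda>j. m j x) ` J - {0, 1}) \<le> card (?N - {w0})"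
      by (rule surj_card_le[rotated]) (use \<W>(2) in auto)
    also have "\<dots> \<le> n" using ord[OF x] w0 \<W>(2) by simp
    finally show "card ((\<lambda>j. m j x) ` J - {0, 1}) \<le> n" .
  qed
qed

text \<open>
  A colour \<open>i \<le> n\<close> owns the interval \<open>[t\<^sub>2\<^sub>i, t\<^sub>2\<^sub>i\<^sub>+\<^sub>1]\<close>; as these \<open>n + 1\<close> intervals are disjoint, one of
  them contains none of the at most \<open>n\<close> intermediate values at a given point.
\<close>

lemma covering_dim_le_thicken_pairs:
  fixes C D :: "'j \<Rightarrow> 'a set" and c :: "'j \<Rightarrow> nat"
  assumes "metrizable_space Y" and "covering_dim_le Y n" and "finite J"
    and closed: "\<And>j. j \<in> J \<Longrightarrow> closedin Y (C j) \<and> closedin Y (D j) \<and> disjnt (C j) (D j)"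
  obtains C' D' :: "'j \<Rightarrow> 'a set"
  where "\<And>j. j \<in> J \<Longrightarrow> closedin Y (C' j) \<and> closedin Y (D' j) \<and> disjnt (C' j) (D' j)"
    "\<And>j. j \<in> J \<Longrightarrow> C j \<subseteq> Y interior_of C' j \<and> D j \<subseteq> Y interior_of D' j"
    "\<And>x. x \<in> topspace Y \<Longrightarrow>
      \<exists>i\<le>n. \<forall>j\<in>J. c j = i \<longrightarrow> x \<in> Y interior_of C' j \<union> Y interior_of D' j"
proof -
  obtain m :: "'j \<Rightarrow> 'a \<Rightarrow> real"
    where cont: "\<And>j. j \<in> J \<Longrightarrow> continuous_map Y euclideanreal (m j)"
    and one: "\<And>j x. j \<in> J \<Longrightarrow> x \<in> C j \<Longrightarrow> m j x = 1"
    and zero: "\<And>j x. j \<in> J \<Longrightarrow> x \<in> D j \<Longrightarrow> m j x = 0"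
    and card: "\<And>x. x \<in> topspace Y \<Longrightarrow> card ((\<lambda>j. m j x) ` J - {0, 1}) \<le> n"
    using covering_dim_le_Urysohn_functions[OF assms(1-3), of C D] closed by metis
  \<comment> \<open>Any strictly increasing sequence strictly between 0 and 1 would do:
    \<open>t01\<close> and \<open>tmono\<close> are all that the argument asks of it.\<close>
  define t where "t = (\<lambda>k::nat. (real k + 1) / (real k + 2))"
  have t01: "0 < t k" "t k < 1" for k by (auto simp: t_def)
  have tmono: "t k < t l" if "k < l" for k l
    using that by (simp add: t_def field_simps)
  define C' where "C' = (\<lambda>j. {x\<in>topspace Y. m j x \<in> {t (2 * c j + 1)..}})"
  define D' where "D' = (\<lambda>j. {x\<in>topspace Y. m j x \<in> {..t (2 * c j)}})"
  have intC: "{x\<in>topspace Y. m j x \<in> {t (2 * c j + 1)<..}} \<subseteq> Y interior_of C' j" if "j \<in> J" for j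
    using cont[OF that] unfolding C'_def
    by (intro interior_of_maximal openin_continuous_map_preimage) auto
  have intD: "{x\<in>topspace Y. m j x \<in> {..<t (2 * c j)}} \<subseteq> Y interior_of D' j" if "j \<in> J" for j
    using cont[OF that] unfolding D'_def
    by (intro interior_of_maximal openin_continuous_map_preimage) auto
  show ?thesis
  proof (rule that[of C' D'])
    fix j assume j: "j \<in> J"
    have "closedin Y (C' j)" "closedin Y (D' j)"
      using cont[OF j] unfolding C'_def D'_def by (auto intro!: closedin_continuous_map_preimage simp del: atLeast_iff atMost_iff)
    moreover have "disjnt (C' j) (D' j)"
      using tmono[of "2 * c j" "2 * c j + 1"] by (auto simp: C'_def D'_def disjnt_iff)
    ultimately show "closedin Y (C' j) \<and> closedin Y (D' j) \<and> disjnt (C' j) (D' j)" by blast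
    have "C j \<subseteq> topspace Y" "D j \<subseteq> topspace Y" using closed[OF j] closedin_subset by blast+
    then have "C j \<subseteq> {x\<in>topspace Y. m j x \<in> {t (2 * c j + 1)<..}}"
      "D j \<subseteq> {x\<in>topspace Y. m j x \<in> {..<t (2 * c j)}}"
      using one[OF j] zero[OF j] t01 by auto
    then show "C j \<subseteq> Y interior_of C' j \<and> D j \<subseteq> Y interior_of D' j"
      using intC[OF j] intD[OF j] by blast
  next
    fix x assume x: "x \<in> topspace Y"
    show "\<exists>i\<le>n. \<forall>j\<in>J. c j = i \<longrightarrow> x \<in> Y interior_of C' j \<union> Y interior_of D' j"
    proof (rule ccontr)
      assume "\<not> ?thesis"
      then obtain f where f: "\<And>i. i \<le> n \<Longrightarrow> f i \<in> J \<and> c (f i) = i \<and>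
          x \<notin> Y interior_of C' (f i) \<union> Y interior_of D' (f i)"
        by metis
      have val: "t (2 * i) \<le> m (f i) x \<and> m (f i) x \<le> t (2 * i + 1)" if "i \<le> n" for i
        using f[OF that] intC[of "f i"] intD[of "f i"] x by force
      have lt: "m (f i) x < m (f i') x" if "i < i'" "i' \<le> n" for i i'
        using val[of i] val[of i'] tmono[of "2 * i + 1" "2 * i'"] that by fastforce
      have "inj_on (\<lambda>i. m (f i) x) {..n}"
      proof (rule inj_onI)
        fix i i' assume "i \<in> {..n}" "i' \<in> {..n}" "m (f i) x = m (f i') x"
        then show "i = i'" using lt[of i i'] lt[of i' i] by (cases i i' rule: linorder_cases) auto
      qed
      then have "n + 1 = card ((\<lambda>i. m (f i) x) ` {..n})" by (simp add: card_image)
      also have "\<dots> \<le> card ((\<lambda>j. m j x) ` J - {0, 1})"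
      proof (rule card_mono)
        show "(\<lambda>i. m (f i) x) ` {..n} \<subseteq> (\<lambda>j. m j x) ` J - {0, 1}"
        proof
          fix y assume "y \<in> (\<lambda>i. m (f i) x) ` {..n}"
          then obtain i where i: "i \<le> n" "y = m (f i) x" by auto
          then have "0 < y" "y < 1" using val[of i] t01[of "2*i"] t01[of "2*i+1"] by auto
          then show "y \<in> (\<lambda>j. m j x) ` J - {0, 1}" using f i by auto
        qed
      qed (use \<open>finite J\<close> in simp)
      also have "\<dots> \<le> n" by (rule card[OF x])
      finally show False by simp
    qed
  qed
qed

text \<open>
  Every pair gets \<open>n + 1\<close> coloured partitions; stage \<open>k\<close> of the construction thickens the pairs with
  index at most \<open>k\<close>. No point lies on partitions of all colours, so the points that avoid all
  partitions of colour \<open>i\<close> yield a decomposition without an appeal to the sum theorem.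
\<close>

lemma covering_dim_le_partitions:
  fixes C D :: "nat \<Rightarrow> 'a set"
  assumes "metrizable_space Y" and "covering_dim_le Y n"
    and closed: "\<And>p. closedin Y (C p)" "\<And>p. closedin Y (D p)" "\<And>p. disjnt (C p) (D p)"
  obtains U V :: "nat \<Rightarrow> nat \<Rightarrow> 'a set"
  where "\<And>p i. openin Y (U p i)" "\<And>p i. openin Y (V p i)" "\<And>p i. disjnt (U p i) (V p i)"
    "\<And>p i. i \<le> n \<Longrightarrow> C p \<subseteq> U p i" "\<And>p i. i \<le> n \<Longrightarrow> D p \<subseteq> V p i"
    "\<And>x. x \<in> topspace Y \<Longrightarrow> \<exists>i\<le>n. \<forall>p. x \<in> U p i \<union> V p i"
proof -
  let ?J = "\<lambda>k::nat. {..k} \<times> {..n}"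
  let ?int = "\<lambda>S. Y interior_of S"
  define P where "P = (\<lambda>(k::nat) (s :: (nat \<times> nat \<Rightarrow> 'a set) \<times> (nat \<times> nat \<Rightarrow> 'a set)).
      \<forall>j. closedin Y (fst s j) \<and> closedin Y (snd s j) \<and> disjnt (fst s j) (snd s j)
      \<and> C (fst j) \<subseteq> fst s j \<and> D (fst j) \<subseteq> snd s j)"
  \<comment> \<open>The middle clause puts each set with index in \<open>?J k\<close> into the
    interior of its successor. This is why \<open>U\<close> and \<open>V\<close> below can be unions
    of interiors, hence open, and still contain \<open>C p\<close> and \<open>D p\<close>.\<close>
  define Q where "Q = (\<lambda>k s s'. (\<forall>j. fst s j \<subseteq> fst s' j \<and> snd s j \<subseteq> snd s' j) \<and>
      (\<forall>j\<in>?J k. fst s j \<subseteq> ?int (fst s' j) \<and> snd s j \<subseteq> ?int (snd s' j)) \<and>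
      (\<forall>x\<in>topspace Y. \<exists>i\<le>n. \<forall>j\<in>?J k. snd j = i \<longrightarrow> x \<in> ?int (fst s' j) \<union> ?int (snd s' j)))"
  have "\<exists>s. \<forall>k. P k (s k) \<and> Q k (s k) (s (Suc k))"
  proof (rule dependent_nat_choice)
    show "\<exists>s. P 0 s"
      by (rule exI[of _ "(\<lambda>j. C (fst j), \<lambda>j. D (fst j))"]) (simp add: P_def closed)
  next
    fix s k assume "P k s"
    then have s: "closedin Y (fst s j)" "closedin Y (snd s j)" "disjnt (fst s j) (snd s j)"
      "C (fst j) \<subseteq> fst s j" "D (fst j) \<subseteq> snd s j" for j
      unfolding P_def by blast+
    have "finite (?J k)" by simp
    from covering_dim_le_thicken_pairs[OF assms(1,2) this, of "fst s" "snd s" snd] s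
    obtain C' D' where
      cl: "\<And>j. j \<in> ?J k \<Longrightarrow> closedin Y (C' j) \<and> closedin Y (D' j) \<and> disjnt (C' j) (D' j)"
      and int: "\<And>j. j \<in> ?J k \<Longrightarrow> fst s j \<subseteq> ?int (C' j) \<and> snd s j \<subseteq> ?int (D' j)"
      and cov: "\<And>x. x \<in> topspace Y \<Longrightarrow>
        \<exists>i\<le>n. \<forall>j\<in>?J k. snd j = i \<longrightarrow> x \<in> ?int (C' j) \<union> ?int (D' j)"
      by metis
    define s' where "s' = ((\<lambda>j. if j \<in> ?J k then C' j else fst s j), (\<lambda>j. if j \<in> ?J k then D' j else snd s j))"
    have sub: "fst s j \<subseteq> fst s' j \<and> snd s j \<subseteq> snd s' j" for j
      using int[of j] interior_of_subset[of Y] by (fastforce simp: s'_def)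
    have "P (Suc k) s'"
      unfolding P_def
    proof (intro allI conjI)
      fix j
      show "closedin Y (fst s' j)" "closedin Y (snd s' j)" "disjnt (fst s' j) (snd s' j)"
        using cl[of j] s(1-3)[of j] by (simp_all add: s'_def split del: if_split split: if_split)
      show "C (fst j) \<subseteq> fst s' j" "D (fst j) \<subseteq> snd s' j" using sub[of j] s(4,5)[of j] by auto
    qed
    moreover have "Q k s s'"
      unfolding Q_def
    proof (intro conjI allI ballI)
      fix x assume "x \<in> topspace Y"
      then obtain i where i: "i \<le> n" "\<And>j. j \<in> ?J k \<Longrightarrow> snd j = i \<Longrightarrow> x \<in> ?int (C' j) \<union> ?int (D' j)"
        using cov by meson
      show "\<exists>i\<le>n. \<forall>j\<in>?J k. snd j = i \<longrightarrow> x \<in> ?int (fst s' j) \<union> ?int (snd s' j)"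
        by (rule exI[of _ i]) (use i in \<open>simp add: s'_def\<close>)
    qed (use sub int in \<open>simp_all add: s'_def\<close>)
    ultimately show "\<exists>s'. P (Suc k) s' \<and> Q k s s'" by blast
  qed
  then obtain s where P: "\<And>k. P k (s k)" and Q: "\<And>k. Q k (s k) (s (Suc k))" by blast
  define U where "U = (\<lambda>p i. \<Union>k. ?int (fst (s k) (p, i)))"
  define V where "V = (\<lambda>p i. \<Union>k. ?int (snd (s k) (p, i)))"
  have mono: "fst (s k) j \<subseteq> fst (s l) j \<and> snd (s k) j \<subseteq> snd (s l) j" if "k \<le> l" for k l j
    using that
  proof (induction rule: dec_induct)
    case (step l)
    have "fst (s l) j \<subseteq> fst (s (Suc l)) j \<and> snd (s l) j \<subseteq> snd (s (Suc l)) j"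
      using Q[of l] unfolding Q_def by blast
    with step show ?case by blast
  qed simp
  show ?thesis
  proof (rule that[of U V])
    fix p i
    show "openin Y (U p i)" "openin Y (V p i)" by (auto simp: U_def V_def)
    show "disjnt (U p i) (V p i)"
    proof (unfold disjnt_iff, intro allI notI)
      fix x assume "x \<in> U p i \<and> x \<in> V p i"
      then obtain k l where "x \<in> ?int (fst (s k) (p, i))" "x \<in> ?int (snd (s l) (p, i))"
        unfolding U_def V_def by auto
      then have "x \<in> fst (s k) (p, i)" "x \<in> snd (s l) (p, i)"
        by (auto dest: subsetD[OF interior_of_subset])
      then have "x \<in> fst (s (max k l)) (p, i)" "x \<in> snd (s (max k l)) (p, i)"
        using mono[of k "max k l"] mono[of l "max k l"] max.cobounded1 max.cobounded2 by blast+
      then show False using P[of "max k l"] unfolding P_def disjnt_iff by blast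
    qed
    assume "i \<le> n"
    then have j: "(p, i) \<in> ?J p" by simp
    have "C p \<subseteq> fst (s p) (p, i)" "D p \<subseteq> snd (s p) (p, i)"
      using P[of p] unfolding P_def by (metis fst_conv)+
    moreover have "fst (s p) (p, i) \<subseteq> ?int (fst (s (Suc p)) (p, i))" 
      "snd (s p) (p, i) \<subseteq> ?int (snd (s (Suc p)) (p, i))"
      using Q[of p] j unfolding Q_def by blast+
    ultimately show "C p \<subseteq> U p i" "D p \<subseteq> V p i" unfolding U_def V_def by blast+
  next
    fix x assume x: "x \<in> topspace Y"
    show "\<exists>i\<le>n. \<forall>p. x \<in> U p i \<union> V p i"
    proof (rule ccontr)
      assume "\<not> ?thesis"
      then obtain q where q: "\<And>i. i \<le> n \<Longrightarrow> x \<notin> U (q i) i \<union> V (q i) i" by metis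
      \<comment> \<open>Each stage offers a colour, which may change with the stage. If every colour
        \<open>i\<close> failed at some index \<open>q i\<close>, then one stage \<open>k\<close>
        would handle all these finitely many indices, and the colour offered there would contradict
        its own failure.\<close>
      define k where "k = Max (q ` {..n})"
      have qk: "q i \<le> k" if "i \<le> n" for i using that by (simp add: k_def)
      obtain i where i: "i \<le> n" "\<And>j. j \<in> ?J k \<Longrightarrow> snd j = i \<Longrightarrow>
          x \<in> ?int (fst (s (Suc k)) j) \<union> ?int (snd (s (Suc k)) j)"
        using Q[of k] x unfolding Q_def by meson
      have "x \<in> ?int (fst (s (Suc k)) (q i, i)) \<union> ?int (snd (s (Suc k)) (q i, i))"
        by (rule i(2)) (use i(1) qk in auto)
      then have "x \<in> U (q i) i \<union> V (q i) i" unfolding U_def V_def by blast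
      with q[OF i(1)] show False by blast
    qed
  qed
qed

section \<open>Zero dimensional pieces from countably many partitions\<close>

lemma metrizable_separable_imp_second_countable:
  assumes "metrizable_space X" "separable_space X"
  shows "second_countable X"
proof -
  obtain M d where "Metric_space M d" and X: "X = Metric_space.mtopology M d"
    using assms(1) unfolding metrizable_space_def by blast
  then interpret Metric_space M d by simp
  obtain Q where Q: "countable Q" "Q \<subseteq> M" "mtopology closure_of Q = M"
    using assms(2) unfolding X separable_space_def by auto
  define \<B> where "\<B> = (\<lambda>(q, k::nat). mball q (inverse (real (Suc k)))) ` (Q \<times> UNIV)"
  show ?thesis
    unfolding second_countable_def X
  proof (intro exI[of _ \<B>] conjI allI impI ballI)
    show "countable \<B>" unfolding \<B>_def using Q(1) by simp
    show "openin mtopology B" if "B \<in> \<B>" for B using that by (auto simp: \<B>_def)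
    fix U x assume Ux: "openin mtopology U \<and> x \<in> U"
    then obtain r where r: "r > 0" "mball x r \<subseteq> U" and xM: "x \<in> M"
      unfolding openin_mtopology by blast
    obtain k where k: "inverse (real (Suc k)) < r / 2"
      using reals_Archimedean[of "r / 2"] r by auto
    have "x \<in> mtopology closure_of Q" using Q(3) xM by simp
    then have "\<forall>r>0. \<exists>q\<in>Q. q \<in> mball x r" unfolding metric_closure_of by blast
    moreover have "0 < inverse (real (Suc k))" by simp
    ultimately obtain q where q: "q \<in> Q" "q \<in> mball x (inverse (real (Suc k)))" by blast
    then have dx: "d x q < inverse (real (Suc k))" and qM: "q \<in> M" by (auto simp del: of_nat_Suc)
    have "mball q (inverse (real (Suc k))) \<subseteq> mball x r"
    proof
      fix y assume "y \<in> mball q (inverse (real (Suc k)))"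
      then have y: "y \<in> M" "d q y < inverse (real (Suc k))" by (auto simp del: of_nat_Suc)
      then have "d x y < r" using triangle[OF xM qM y(1)] dx k by linarith
      then show "y \<in> mball x r" using xM y by simp
    qed
    moreover have "x \<in> mball q (inverse (real (Suc k)))"
      using dx xM qM by (simp add: commute del: of_nat_Suc)
    ultimately show "\<exists>V\<in>\<B>. x \<in> V \<and> V \<subseteq> U"
      unfolding \<B>_def using q(1) r(2) by (intro bexI[of _ "mball q (inverse (real (Suc k)))"]) auto
  qed
qed

text \<open>Take the closure of a basic set \<open>b\<close> and the complement of a basic set
  \<open>b'\<close> that contains this closure. Regularity fits such a pair between a point and any
  neighbourhood, and there are only countably many pairs, as the construction by stages
  requires.\<close>

lemma second_countable_closed_pairs:
  assumes "regular_space Y" "second_countable Y"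
  obtains C D :: "nat \<Rightarrow> 'a set"
  where "\<And>p. closedin Y (C p)" "\<And>p. closedin Y (D p)" "\<And>p. disjnt (C p) (D p)"
    "\<And>x N. openin Y N \<Longrightarrow> x \<in> N \<Longrightarrow> \<exists>p. x \<in> C p \<and> topspace Y - N \<subseteq> D p"
proof -
  obtain \<B> where \<B>: "countable \<B>" "\<And>V. V \<in> \<B> \<Longrightarrow> openin Y V"
    and base: "\<And>U x. openin Y U \<and> x \<in> U \<Longrightarrow> \<exists>V\<in>\<B>. x \<in> V \<and> V \<subseteq> U"
    using assms(2) unfolding second_countable_def by blast
  \<comment> \<open>The trivial pair keeps \<open>\<P>\<close> nonempty, so that
    \<open>from_nat_into\<close> enumerates it by all natural numbers.\<close>
  define \<P> where "\<P> = insert ({}, {}) {p \<in> \<B> \<times> \<B>. Y closure_of fst p \<subseteq> snd p}"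
  have cnt: "countable \<P>" unfolding \<P>_def using \<B>(1) by (intro countable_insert countable_Collect) auto
  have ne: "\<P> \<noteq> {}" by (simp add: \<P>_def)
  define f where "f = from_nat_into \<P>"
  have f: "f p \<in> \<P>" for p unfolding f_def by (rule from_nat_into[OF ne])
  show ?thesis
  proof (rule that[of "\<lambda>p. Y closure_of fst (f p)" "\<lambda>p. topspace Y - snd (f p)"])
    fix p
    show "closedin Y (Y closure_of fst (f p))" by simp
    have "openin Y (snd (f p))" using f[of p] \<B>(2) by (auto simp: \<P>_def)
    then show "closedin Y (topspace Y - snd (f p))" by blast
    show "disjnt (Y closure_of fst (f p)) (topspace Y - snd (f p))"
      using f[of p] by (auto simp: \<P>_def disjnt_iff)
  next
    fix x N assume N: "openin Y N" "x \<in> N"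
    then obtain b' where b': "b' \<in> \<B>" "x \<in> b'" "b' \<subseteq> N" using base by blast
    then have "closedin Y (topspace Y - b') \<and> x \<in> topspace Y - (topspace Y - b')"
      using \<B>(2) openin_subset by fastforce
    then obtain U where U: "openin Y U" "x \<in> U" "disjnt (topspace Y - b') (Y closure_of U)"
      using assms(1) unfolding regular_space by blast
    then obtain b where b: "b \<in> \<B>" "x \<in> b" "b \<subseteq> U" using base by blast
    have "Y closure_of b \<subseteq> b'"
      using closure_of_mono[OF b(3), of Y] U(3) closure_of_subset_topspace[of Y U] unfolding disjnt_iff by blast
    then have "(b, b') \<in> \<P>" using b b' by (simp add: \<P>_def)
    then obtain p where p: "f p = (b, b')" unfolding f_def using from_nat_into_surj[OF cnt] by blast
    have "b \<subseteq> Y closure_of b" using \<B>(2)[OF b(1)] by (simp add: closure_of_subset openin_subset)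
    then show "\<exists>p. x \<in> Y closure_of fst (f p) \<and> topspace Y - N \<subseteq> topspace Y - snd (f p)"
      using p b b' by (intro exI[of _ p]) auto
  qed
qed

text \<open>The witnessing families are disjoint and open in the whole space, not only in \<open>Z\<close>.\<close>

definition zero_dimensional_in :: "'a topology \<Rightarrow> 'a set \<Rightarrow> bool" where
  "zero_dimensional_in X Z \<longleftrightarrow> (\<forall>\<A>\<in>open_covers X. \<exists>\<B>. (\<forall>B\<in>\<B>. openin X B) \<and>
     pairwise disjnt \<B> \<and> refines \<B> \<A> \<and> Z \<subseteq> \<Union>\<B>)"

text \<open>On \<open>Z i\<close> the sets \<open>U p i\<close> and \<open>V p i\<close> are
  complementary, so \<open>U p i\<close> is relatively clopen there; by \<open>nbhd\<close>, some
  \<open>U p i\<close> fits between a point of \<open>Z i\<close> and any neighbourhood. So colour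
  \<open>i\<close> provides a countable clopen base on \<open>Z i\<close>.\<close>

lemma covering_dim_le_decomposition:
  assumes "metrizable_space Y" "second_countable Y" "covering_dim_le Y n"
  obtains Z where "topspace Y = (\<Union>i\<le>n. Z i)" "\<And>i. i \<le> n \<Longrightarrow> zero_dimensional_in Y (Z i)"
proof -
  obtain C D :: "nat \<Rightarrow> 'a set"
    where CD: "\<And>p. closedin Y (C p)" "\<And>p. closedin Y (D p)" "\<And>p. disjnt (C p) (D p)"
    and nbhd: "\<And>x N. openin Y N \<Longrightarrow> x \<in> N \<Longrightarrow> \<exists>p. x \<in> C p \<and> topspace Y - N \<subseteq> D p"
    by (rule second_countable_closed_pairs[OF metrizable_imp_regular_space[OF assms(1)] assms(2)])
      blast
  obtain U V :: "nat \<Rightarrow> nat \<Rightarrow> 'a set"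
    where UV: "\<And>p i. openin Y (U p i)" "\<And>p i. openin Y (V p i)" "\<And>p i. disjnt (U p i) (V p i)"
    and CU: "\<And>p i. i \<le> n \<Longrightarrow> C p \<subseteq> U p i" and DV: "\<And>p i. i \<le> n \<Longrightarrow> D p \<subseteq> V p i"
    and cov: "\<And>x. x \<in> topspace Y \<Longrightarrow> \<exists>i\<le>n. \<forall>p. x \<in> U p i \<union> V p i"
    by (rule covering_dim_le_partitions[of Y n C D, OF assms(1,3) CD]) blast
  define Z where "Z = (\<lambda>i. {x\<in>topspace Y. \<forall>p. x \<in> U p i \<union> V p i})"
  show ?thesis
  proof (rule that[of Z])
    show "topspace Y = (\<Union>i\<le>n. Z i)"
    proof
      show "topspace Y \<subseteq> (\<Union>i\<le>n. Z i)" using cov by (fastforce simp: Z_def)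
    qed (auto simp: Z_def)
  next
    fix i assume i: "i \<le> n"
    show "zero_dimensional_in Y (Z i)"
      unfolding zero_dimensional_in_def
    proof
      fix \<A> assume \<A>: "\<A> \<in> open_covers Y"
      define P where "P = {p. \<exists>a\<in>\<A>. U p i \<subseteq> a}"
      \<comment> \<open>First-fit disjointing. Subtracting the earlier \<open>U q i\<close> could
        destroy openness; intersecting with \<open>V q i\<close> instead keeps the sets open and
        disjoint in all of \<open>Y\<close> and loses no point of \<open>Z i\<close>.\<close>
      define G where "G = (\<lambda>p. U p i \<inter> (\<Inter>q\<in>P \<inter> {..<p}. V q i) \<inter> topspace Y)"
      have "openin Y (G p)" for p
      proof -
        have "G p = U p i \<inter> \<Inter>(insert (topspace Y) ((\<lambda>q. V q i) ` (P \<inter> {..<p})))"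
          by (auto simp: G_def)
        moreover have "openin Y (\<Inter>(insert (topspace Y) ((\<lambda>q. V q i) ` (P \<inter> {..<p}))))"
          by (rule openin_Inter) (use UV(2) in auto)
        ultimately show ?thesis using UV(1) by (simp add: openin_Int)
      qed
      moreover have "pairwise disjnt (G ` P)"
      proof (rule pairwiseI)
        have *: "disjnt (G p) (G q)" if "p \<in> P" "p < q" for p q
          using that UV(3)[of p i] by (auto simp: G_def disjnt_iff)
        fix X Y' assume "X \<in> G ` P" "Y' \<in> G ` P" "X \<noteq> Y'"
        then obtain p q where pq: "p \<in> P" "q \<in> P" "X = G p" "Y' = G q" "p \<noteq> q" by blast
        then show "disjnt X Y'"
          using *[of p q] *[of q p] disjnt_sym by (cases p q rule: linorder_cases) auto
      qed
      moreover have "refines (G ` P) \<A>"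
        unfolding refines_def P_def G_def by blast
      moreover have "Z i \<subseteq> \<Union>(G ` P)"
      proof
        fix x assume x: "x \<in> Z i"
        then obtain a where a: "a \<in> \<A>" "x \<in> a" "openin Y a"
          using \<A> unfolding open_covers_def Z_def by blast
        then obtain p where p: "x \<in> C p" "topspace Y - a \<subseteq> D p" using nbhd by blast
        have "U p i \<subseteq> a"
          using p(2) DV[OF i, of p] UV(3)[of p i] openin_subset[OF UV(1)[of p i]]
          unfolding disjnt_iff by blast
        then have ex: "p \<in> P \<and> x \<in> U p i" using a p(1) CU[OF i] by (auto simp: P_def)
        define q where "q = (LEAST p. p \<in> P \<and> x \<in> U p i)"
        have q: "q \<in> P" "x \<in> U q i" using LeastI[of "\<lambda>p. p \<in> P \<and> x \<in> U p i", OF ex] by (auto simp: q_def)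
        have "x \<in> V l i" if "l \<in> P" "l < q" for l
          using not_less_Least[of l "\<lambda>p. p \<in> P \<and> x \<in> U p i"] that x by (auto simp: q_def Z_def)
        then have "x \<in> G q" using q x by (auto simp: G_def Z_def)
        with q show "x \<in> \<Union>(G ` P)" by blast
      qed
      ultimately show "\<exists>\<B>. (\<forall>B\<in>\<B>. openin Y B) \<and> pairwise disjnt \<B> \<and> refines \<B> \<A> \<and> Z i \<subseteq> \<Union>\<B>"
        by (intro exI[of _ "G ` P"]) auto
    qed
  qed
qed

text \<open>Balls of half the admissible radius: if two of them meet, their centres are closer than
  the larger full radius, so one centre lies in the full ball around the other and hence in the
  wrong member of \<open>\<G>\<close>.\<close>

lemma metrizable_extend_disjoint_open:
  assumes "metrizable_space X" "T \<subseteq> topspace X" "pairwise disjnt \<G>"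
    and "\<And>G. G \<in> \<G> \<Longrightarrow> openin (subtopology X T) G"
  obtains e where "\<And>G. G \<in> \<G> \<Longrightarrow> openin X (e G)" "\<And>G. G \<in> \<G> \<Longrightarrow> G \<subseteq> e G"
    "\<And>G H. G \<in> \<G> \<Longrightarrow> H \<in> \<G> \<Longrightarrow> G \<noteq> H \<Longrightarrow> disjnt (e G) (e H)"
proof -
  obtain M d where "Metric_space M d" and X: "X = Metric_space.mtopology M d"
    using assms(1) unfolding metrizable_space_def by blast
  then interpret Metric_space M d by simp
  have TM: "T \<subseteq> M" using assms(2) by (simp add: X)
  have "\<exists>r>0. mball x r \<inter> T \<subseteq> G" if G: "G \<in> \<G>" "x \<in> G" for G x
  proof -
    obtain W where W: "openin mtopology W" "G = W \<inter> T"
      using assms(4)[OF G(1)] unfolding X openin_subtopology by blast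
    then obtain r where "r > 0" "mball x r \<subseteq> W" using G(2) unfolding openin_mtopology by blast
    with W show ?thesis by blast
  qed
  then obtain r where r: "\<And>G x. G \<in> \<G> \<Longrightarrow> x \<in> G \<Longrightarrow> 0 < r G x \<and> mball x (r G x) \<inter> T \<subseteq> G"
    by metis
  have GT: "G \<subseteq> T" if "G \<in> \<G>" for G
    using openin_subset[OF assms(4)[OF that]] by simp
  define e where "e = (\<lambda>G. \<Union>x\<in>G. mball x (r G x / 2))"
  show ?thesis
  proof (rule that[of e])
    fix G assume G: "G \<in> \<G>"
    show "openin X (e G)" unfolding e_def X by (intro openin_Union) auto
    show "G \<subseteq> e G" using r[OF G] GT[OF G] TM by (fastforce simp: e_def)
    fix H assume H: "H \<in> \<G>" "G \<noteq> H"
    have GH: "disjnt G H" using assms(3) G H by (simp add: pairwise_def)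
    show "disjnt (e G) (e H)"
    proof (unfold disjnt_iff, intro allI notI)
      fix z assume "z \<in> e G \<and> z \<in> e H"
      then obtain x y where x: "x \<in> G" "x \<in> M" "z \<in> M" "d x z < r G x / 2"
        and y: "y \<in> H" "y \<in> M" "d y z < r H y / 2" by (auto simp: e_def)
      have xy: "d x y < r G x / 2 + r H y / 2"
        using triangle[OF x(2,3) y(2)] x(4) y(3) commute[of y z] by linarith
      show False
      proof (cases "r H y \<le> r G x")
        case True
        then have "y \<in> mball x (r G x) \<inter> T" using xy x y GT[OF H(1)] by auto
        then show False using r[OF G x(1)] GH y(1) by (auto simp: disjnt_iff)
      next
        case False
        then have "x \<in> mball y (r H y) \<inter> T" using xy x y GT[OF G] commute[of x y] by auto
        then show False using r[OF H(1) y(1)] GH x(1) by (auto simp: disjnt_iff)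
      qed
    qed
  qed
qed

text \<open>An enlarged set \<open>e G\<close> may stick out of the cover member containing
  \<open>G\<close>; cutting it back to \<open>a G\<close> restores the refinement and keeps it open
  and disjoint from the others.\<close>

lemma zero_dimensional_in_subtopology:
  assumes "metrizable_space X" "T \<subseteq> topspace X" "zero_dimensional_in (subtopology X T) Z"
  shows "zero_dimensional_in X Z"
  unfolding zero_dimensional_in_def
proof
  fix \<A> assume \<A>: "\<A> \<in> open_covers X"
  then have "(\<lambda>a. T \<inter> a) ` \<A> \<in> open_covers (subtopology X T)"
    using assms(2) unfolding open_covers_def by (auto intro: openin_subtopology_Int2)
  then obtain \<G> where \<G>: "\<And>G. G \<in> \<G> \<Longrightarrow> openin (subtopology X T) G" "pairwise disjnt \<G>"
      "refines \<G> ((\<lambda>a. T \<inter> a) ` \<A>)" "Z \<subseteq> \<Union>\<G>"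
    using assms(3) unfolding zero_dimensional_in_def by meson
  obtain e where e: "\<And>G. G \<in> \<G> \<Longrightarrow> openin X (e G)" "\<And>G. G \<in> \<G> \<Longrightarrow> G \<subseteq> e G"
    "\<And>G H. G \<in> \<G> \<Longrightarrow> H \<in> \<G> \<Longrightarrow> G \<noteq> H \<Longrightarrow> disjnt (e G) (e H)"
    using metrizable_extend_disjoint_open[OF assms(1,2) \<G>(2,1)] by metis
  have "\<exists>a. a \<in> \<A> \<and> G \<subseteq> a" if "G \<in> \<G>" for G
    using \<G>(3) that unfolding refines_def by blast
  then obtain a where a: "\<And>G. G \<in> \<G> \<Longrightarrow> a G \<in> \<A> \<and> G \<subseteq> a G" by metis
  show "\<exists>\<B>. (\<forall>B\<in>\<B>. openin X B) \<and> pairwise disjnt \<B> \<and> refines \<B> \<A> \<and> Z \<subseteq> \<Union>\<B>"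
  proof (intro exI[of _ "(\<lambda>G. e G \<inter> a G) ` \<G>"] conjI ballI)
    show "openin X B" if "B \<in> (\<lambda>G. e G \<inter> a G) ` \<G>" for B
      using that e(1) a \<A> unfolding open_covers_def by auto
    show "pairwise disjnt ((\<lambda>G. e G \<inter> a G) ` \<G>)"
    proof (rule pairwiseI)
      fix A B assume "A \<in> (\<lambda>G. e G \<inter> a G) ` \<G>" "B \<in> (\<lambda>G. e G \<inter> a G) ` \<G>" "A \<noteq> B"
      then obtain G H where "G \<in> \<G>" "H \<in> \<G>" "G \<noteq> H" "A = e G \<inter> a G" "B = e H \<inter> a H" by blast
      then show "disjnt A B" using e(3)[of G H] by (auto simp: disjnt_iff)
    qed
    show "refines ((\<lambda>G. e G \<inter> a G) ` \<G>) \<A>" unfolding refines_def using a by blast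
    show "Z \<subseteq> \<Union>((\<lambda>G. e G \<inter> a G) ` \<G>)"
    proof
      fix x assume "x \<in> Z"
      then obtain G where G: "G \<in> \<G>" "x \<in> G" using \<G>(4) by blast
      then have "x \<in> e G \<inter> a G" using e(2)[OF G(1)] a[OF G(1)] by blast
      with G(1) show "x \<in> \<Union>((\<lambda>G. e G \<inter> a G) ` \<G>)" by blast
    qed
  qed
qed

text \<open>The pieces form a list because they will be treated one by one in consecutive innings;
  it is nonempty because no block of innings may be empty.\<close>

lemma finite_dimensional_imp_zero_dimensional_pieces:
  assumes "metrizable_space X" "separable_space X" "T \<subseteq> topspace X"
    and "finite_dimensional (subtopology X T)"
  obtains zs where "zs \<noteq> []" "T = \<Union>(set zs)" "\<And>Z. Z \<in> set zs \<Longrightarrow> zero_dimensional_in X Z"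
proof -
  obtain n where n: "covering_dim_le (subtopology X T) n"
    using assms(4) unfolding finite_dimensional_def by blast
  have "second_countable (subtopology X T)"
    using metrizable_separable_imp_second_countable[OF assms(1,2)] by (rule second_countable_subtopology)
  then obtain Z where Z: "topspace (subtopology X T) = (\<Union>i\<le>n. Z i)"
      "\<And>i. i \<le> n \<Longrightarrow> zero_dimensional_in (subtopology X T) (Z i)"
    using covering_dim_le_decomposition[OF metrizable_space_subtopology[OF assms(1)] _ n] by metis
  show ?thesis
  proof (rule that[of "map Z [0..<Suc n]"])
    have "T = topspace (subtopology X T)" using assms(3) by auto
    also have "\<dots> = \<Union>(set (map Z [0..<Suc n]))" unfolding Z(1)
      by (auto simp: atLeast0LessThan lessThan_Suc_atMost simp del: upt_Suc)
    finally show "T = \<Union>(set (map Z [0..<Suc n]))" .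
    show "zero_dimensional_in X z" if "z \<in> set (map Z [0..<Suc n])" for z
      using that Z(2) zero_dimensional_in_subtopology[OF assms(1,3)] by (auto simp del: upt_Suc)
  qed simp
qed

section \<open>Well-orders\<close>

text \<open>If \<open>s\<close> were shorter, mapping it onto the part of \<open>r\<close> below
  some \<open>a\<close> would turn \<open>f\<close> into a strictly increasing self-map of
  \<open>r\<close> that moves \<open>a\<close> down. The least point moved down is impossible, since
  its image is moved down as well.\<close>

lemma strict_mono_imp_ordLeq:
  assumes r: "Well_order r" and s: "Well_order s"
    and fF: "\<And>a. a \<in> Field r \<Longrightarrow> f a \<in> Field s"
    and mono: "\<And>a b. (a, b) \<in> r \<Longrightarrow> a \<noteq> b \<Longrightarrow> (f a, f b) \<in> s \<and> f a \<noteq> f b"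
  shows "r \<le>o s"
proof (rule ccontr)
  interpret wo_rel r using r by (simp add: wo_rel_def)
  assume "\<not> r \<le>o s"
  then have "s <o r" using not_ordLeq_iff_ordLess r s by blast
  then obtain a where a: "a \<in> Field r" "s =o Restr r (underS a)"
    using ordLess_iff_ordIso_Restr[OF r s] by blast
  then obtain g where g: "iso s (Restr r (underS a)) g" unfolding ordIso_def by auto
  have FR: "Field (Restr r (underS a)) = underS a"
    using underS_ofilter r by (intro Field_Restr_ofilter) auto
  have gU: "g x \<in> underS a" if "x \<in> Field s" for x
    using g that unfolding iso_iff2 FR bij_betw_def by blast
  have gmono: "(g x, g y) \<in> r \<and> g x \<noteq> g y" if "(x, y) \<in> s" "x \<noteq> y" for x y
  proof -
    have xy: "x \<in> Field s" "y \<in> Field s" using that by (auto simp: Field_def)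
    then have "(g x, g y) \<in> Restr r (underS a)" using g that unfolding iso_iff2 by blast
    moreover have "g x \<noteq> g y" using g that xy unfolding iso_iff2 bij_betw_def inj_on_def by blast
    ultimately show ?thesis by blast
  qed
  define A where "A = {x \<in> Field r. (g (f x), x) \<in> r \<and> g (f x) \<noteq> x}"
  have "a \<in> A" using gU[OF fF[OF a(1)]] a(1) unfolding A_def underS_def by blast
  then have m: "minim A \<in> A" by (intro minim_in) (auto simp: A_def)
  define m' where "m' = g (f (minim A))"
  have lt: "(m', minim A) \<in> r" "m' \<noteq> minim A" using m unfolding A_def m'_def by auto
  then have "m' \<in> A"
    using gmono mono[OF lt] unfolding A_def m'_def by (auto simp: Field_def)
  then have "(minim A, m') \<in> r" by (intro minim_least) (auto simp: A_def)
  with lt show False using ANTISYM by (auto dest: antisymD)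
qed

section \<open>Ordinal sums and limit lengths\<close>

lemma ord_sum_iff [simp]:
  "(Inl a, Inl b) \<in> r \<oplus>o s \<longleftrightarrow> (a, b) \<in> r"
  "(Inr c, Inr d) \<in> r \<oplus>o s \<longleftrightarrow> (c, d) \<in> s"
  "(Inl a, Inr d) \<in> r \<oplus>o s \<longleftrightarrow> a \<in> Field r \<and> d \<in> Field s"
  "(Inr c, Inl b) \<notin> r \<oplus>o s"
  by (auto simp: ord_sum_def)

lemma Field_ord_sum: "Field (r \<oplus>o s) = Inl ` Field r \<union> Inr ` Field s"
proof
  show "Field (r \<oplus>o s) \<subseteq> Inl ` Field r \<union> Inr ` Field s"
  proof
    fix x assume "x \<in> Field (r \<oplus>o s)"
    then obtain y where "(x, y) \<in> r \<oplus>o s \<or> (y, x) \<in> r \<oplus>o s" unfolding Field_def by blast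
    then show "x \<in> Inl ` Field r \<union> Inr ` Field s"
      by (cases x; cases y) (auto dest: FieldI1 FieldI2)
  qed
  have "Inl a \<in> Field (r \<oplus>o s)" if a: "a \<in> Field r" for a
  proof -
    obtain b where "(a, b) \<in> r \<or> (b, a) \<in> r" using a by (auto simp: Field_def)
    then have "(Inl a, Inl b) \<in> r \<oplus>o s \<or> (Inl b, Inl a) \<in> r \<oplus>o s" by simp
    then show ?thesis unfolding Field_def by blast
  qed
  moreover have "Inr c \<in> Field (r \<oplus>o s)" if c: "c \<in> Field s" for c
  proof -
    obtain d where "(c, d) \<in> s \<or> (d, c) \<in> s" using c by (auto simp: Field_def)
    then have "(Inr c, Inr d) \<in> r \<oplus>o s \<or> (Inr d, Inr c) \<in> r \<oplus>o s" by simp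
    then show ?thesis unfolding Field_def by blast
  qed
  ultimately show "Inl ` Field r \<union> Inr ` Field s \<subseteq> Field (r \<oplus>o s)" by blast
qed

lemma Well_order_ord_sum:
  assumes "Well_order r" "Well_order s"
  shows "Well_order (r \<oplus>o s)"
proof -
  interpret r: wo_rel r using assms by (simp add: wo_rel_def)
  interpret s: wo_rel s using assms by (simp add: wo_rel_def)
  have rF: "(a, b) \<in> r \<Longrightarrow> a \<in> Field r \<and> b \<in> Field r" and sF: "(c, d) \<in> s \<Longrightarrow> c \<in> Field s \<and> d \<in> Field s"
    for a b c d by (auto simp: Field_def)
  have "refl_on (Field (r \<oplus>o s)) (r \<oplus>o s)"
    using r.REFL s.REFL by (auto simp: refl_on_def Field_ord_sum)
  moreover have "r \<oplus>o s \<subseteq> Field (r \<oplus>o s) \<times> Field (r \<oplus>o s)" by (auto simp: Field_def)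
  moreover have "trans (r \<oplus>o s)"
  proof (rule transI)
    fix x y z assume "(x, y) \<in> r \<oplus>o s" "(y, z) \<in> r \<oplus>o s"
    then show "(x, z) \<in> r \<oplus>o s"
      using rF sF r.TRANS s.TRANS by (cases x; cases y; cases z) (auto dest: transD)
  qed
  moreover have "antisym (r \<oplus>o s)"
  proof (rule antisymI)
    fix x y assume "(x, y) \<in> r \<oplus>o s" "(y, x) \<in> r \<oplus>o s"
    then show "x = y"
      using r.ANTISYM s.ANTISYM by (cases x; cases y) (auto dest: antisymD)
  qed
  moreover have "total_on (Field (r \<oplus>o s)) (r \<oplus>o s)"
    using r.TOTALS s.TOTALS unfolding total_on_def Field_ord_sum by (auto; blast)
  moreover have "wf (r \<oplus>o s - Id)"
  proof (rule wfI_min)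
    fix x :: "'a + 'b" and Q assume x: "x \<in> Q"
    have wfr: "\<exists>z\<in>Q'. \<forall>y. (y, z) \<in> r - Id \<longrightarrow> y \<notin> Q'" if "a \<in> Q'" for a Q'
      using wfE_min[OF r.WF that] by metis
    have wfs: "\<exists>z\<in>Q'. \<forall>y. (y, z) \<in> s - Id \<longrightarrow> y \<notin> Q'" if "a \<in> Q'" for a Q'
      using wfE_min[OF s.WF that] by metis
    show "\<exists>z\<in>Q. \<forall>y. (y, z) \<in> r \<oplus>o s - Id \<longrightarrow> y \<notin> Q"
    proof (cases "\<exists>a. Inl a \<in> Q")
      case True
      then obtain z where z: "Inl z \<in> Q" "\<And>y. (y, z) \<in> r - Id \<Longrightarrow> Inl y \<notin> Q"
        using wfr[of _ "{a. Inl a \<in> Q}"] by blast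
      have "y \<notin> Q" if "(y, Inl z) \<in> r \<oplus>o s - Id" for y
        using that z(2) by (cases y) auto
      with z(1) show ?thesis by blast
    next
      case False
      with x obtain b where "Inr b \<in> Q" by (cases x) auto
      then obtain z where z: "Inr z \<in> Q" "\<And>y. (y, z) \<in> s - Id \<Longrightarrow> Inr y \<notin> Q"
        using wfs[of b "{a. Inr a \<in> Q}"] by blast
      have "y \<notin> Q" if "(y, Inr z) \<in> r \<oplus>o s - Id" for y
        using that z(2) False by (cases y) auto
      with z(1) show ?thesis by blast
    qed
  qed
  ultimately show ?thesis
    unfolding well_order_on_def linear_order_on_def partial_order_on_def preorder_on_def by blast
qed

text \<open>\<open>Inr\<close> maps onto a final segment and not onto an initial one, so it need not
  be an embedding of well-orders; strict monotonicity suffices.\<close>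

lemma ord_sum_ordLeq_left:
  assumes "Well_order r" "Well_order s"
  shows "s \<le>o r \<oplus>o s"
  by (rule strict_mono_imp_ordLeq[of _ _ Inr])
    (use assms Well_order_ord_sum in \<open>auto simp: Field_ord_sum\<close>)

lemma limit_ordinal_ord_sum_natLeq:
  assumes "Well_order r"
  shows "limit_ordinal (r \<oplus>o natLeq)"
  unfolding limit_ordinal_def
proof (intro conjI ballI)
  show "Well_order (r \<oplus>o natLeq)" by (rule Well_order_ord_sum[OF assms natLeq_Well_order])
  show "Field (r \<oplus>o natLeq) \<noteq> {}" by (simp add: Field_ord_sum Field_natLeq)
  fix a assume a: "a \<in> Field (r \<oplus>o natLeq)"
  show "\<exists>b\<in>Field (r \<oplus>o natLeq). b \<noteq> a \<and> (a, b) \<in> r \<oplus>o natLeq"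
  proof (cases a)
    case (Inl x)
    then show ?thesis
      using a by (intro bexI[of _ "Inr 0"]) (auto simp: Field_ord_sum Field_natLeq)
  next
    case (Inr n)
    have "(n, Suc n) \<in> natLeq" by (simp add: natLeq_def)
    with Inr show ?thesis
      by (intro bexI[of _ "Inr (Suc n)"]) (auto simp: Field_ord_sum Field_natLeq)
  qed
qed

text \<open>
  Inning \<open>\<delta>\<close> of a simulated play, with history \<open>h\<close>, uses the innings \<open>st A \<delta> i\<close>, \<open>i < len \<delta> h\<close>, of the
  actual play \<open>A\<close>. It starts at most finitely many innings after \<open>\<delta>\<close>, so that the simulation never
  runs out of a limit ordinal. The last property says that the simulation up to an actual inning
  depends only on the moves up to that inning.
\<close>

lemma limit_ordinal_chunks:
  fixes s :: "'i rel" and len :: "'i \<Rightarrow> ('i \<Rightarrow> 'h) \<Rightarrow> nat"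
    and nxt :: "'i \<Rightarrow> ('i \<Rightarrow> 'h) \<Rightarrow> (nat \<Rightarrow> 'a) \<Rightarrow> 'h"
  assumes lim: "limit_ordinal s"
    and len: "\<And>\<delta> h. 0 < len \<delta> h"
    and nxt: "\<And>\<delta> h a b. (\<And>i. i < len \<delta> h \<Longrightarrow> a i = b i) \<Longrightarrow> nxt \<delta> h a = nxt \<delta> h b"
  obtains H :: "('i \<Rightarrow> 'a) \<Rightarrow> 'i \<Rightarrow> 'h" and st :: "('i \<Rightarrow> 'a) \<Rightarrow> 'i \<Rightarrow> nat \<Rightarrow> 'i"
  where "\<And>A \<delta>. H A \<delta> = nxt \<delta> (restrict (H A) (underS s \<delta>)) (\<lambda>i. A (st A \<delta> i))"
    "\<And>A \<delta> i. \<delta> \<in> Field s \<Longrightarrow> st A \<delta> i \<in> Field s"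
    "\<And>A \<delta> \<epsilon> i j. \<delta> \<in> Field s \<Longrightarrow> \<epsilon> \<in> Field s \<Longrightarrow> i < len \<delta> (restrict (H A) (underS s \<delta>)) \<Longrightarrow>
       j < len \<epsilon> (restrict (H A) (underS s \<epsilon>)) \<Longrightarrow> st A \<delta> i = st A \<epsilon> j \<Longrightarrow> \<delta> = \<epsilon> \<and> i = j"
    "\<And>A B \<delta> i. \<delta> \<in> Field s \<Longrightarrow> (\<And>x. x \<in> under s (st A \<delta> i) \<Longrightarrow> A x = B x) \<Longrightarrow>
       st B \<delta> i = st A \<delta> i \<and> restrict (H B) (underS s \<delta>) = restrict (H A) (underS s \<delta>)"
proof -
  have wo: "Well_order s" using lim unfolding limit_ordinal_def by blast
  interpret wo_rel s using wo by (simp add: wo_rel_def)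
  define lt where "lt = (\<lambda>x y. (x, y) \<in> s \<and> x \<noteq> y)"
  define le where "le = (\<lambda>x y. (x, y) \<in> s)"
  have le_refl: "le x x" if "x \<in> Field s" for x
    using REFL that by (simp add: le_def refl_on_def)
  have le_trans: "le x y \<Longrightarrow> le y z \<Longrightarrow> le x z" for x y z
    using TRANS unfolding le_def by (rule transD)
  have le_antisym: "le x y \<Longrightarrow> le y x \<Longrightarrow> x = y" for x y
    using ANTISYM unfolding le_def by (rule antisymD)
  have lt_le: "lt x y \<Longrightarrow> le x y" for x y by (simp add: lt_def le_def)
  have lt_le_trans: "lt x y \<Longrightarrow> le y z \<Longrightarrow> lt x z" and le_lt_trans: "le x y \<Longrightarrow> lt y z \<Longrightarrow> lt x z" for x y z
    using le_trans[of x y z] le_antisym[of x y] le_antisym[of y z] by (auto simp: lt_def le_def)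
  have lt_irrefl: "\<not> lt x x" for x by (simp add: lt_def)
  have leF: "le x y \<Longrightarrow> x \<in> Field s \<and> y \<in> Field s" for x y by (auto simp: le_def Field_def)
  have ltF: "lt x y \<Longrightarrow> x \<in> Field s \<and> y \<in> Field s" for x y using lt_le leF by blast
  have lin: "lt x y \<or> x = y \<or> lt y x" if "x \<in> Field s" "y \<in> Field s" for x y
    using TOTALS that by (auto simp: lt_def)
  have uS: "x \<in> underS y \<longleftrightarrow> lt x y" for x y by (auto simp: underS_def lt_def)
  \<comment> \<open>The immediate successor, which exists everywhere because a limit ordinal has no
    last element; \<open>pl x i\<close> below is x + i.\<close>
  define sc where "sc = (\<lambda>x. suc {x})"
  have sc: "lt x (sc x)" "\<And>y. lt x y \<Longrightarrow> le (sc x) y" if "x \<in> Field s" for x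
  proof -
    have "AboveS {x} \<noteq> {}" using lim that unfolding limit_ordinal_def AboveS_def by blast
    with suc_greater[of "{x}" x] that show "lt x (sc x)" by (auto simp: lt_def sc_def)
    show "le (sc x) y" if "lt x y" for y
      using suc_least_AboveS[of y "{x}"] that ltF[OF that] by (auto simp: lt_def le_def sc_def AboveS_def)
  qed
  have scF: "sc x \<in> Field s" if "x \<in> Field s" for x using sc(1)[OF that] ltF by blast
  have sc_mono: "le (sc x) (sc y)" if "le x y" for x y
    using that leF[OF that] by (intro sc(2)) (auto intro: le_lt_trans sc(1))
  define pl where "pl = (\<lambda>x i. (sc ^^ i) x)"
  have pl0: "pl x 0 = x" and plS: "pl x (Suc i) = sc (pl x i)" and pl_add: "pl (pl x i) j = pl x (i + j)" for x i j
    by (simp_all add: pl_def funpow_add[symmetric] add.commute) (metis comp_apply funpow_add add.commute)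
  have plF: "pl x i \<in> Field s" if "x \<in> Field s" for x i
    by (induction i) (use that scF in \<open>auto simp: pl0 plS\<close>)
  have pl_lt: "lt (pl x i) (pl x j)" if x: "x \<in> Field s" and "i < j" for x i j
    using \<open>i < j\<close>
  proof (induction j)
    case (Suc j)
    have "lt (pl x j) (pl x (Suc j))" using sc(1)[OF plF[OF x]] by (simp add: plS)
    with Suc show ?case by (cases "i = j") (auto intro: lt_le_trans lt_le)
  qed simp
  have pl_ge: "le x (pl x i)" if "x \<in> Field s" for x i
    using pl_lt[OF that, of 0 i] le_refl[OF that] by (cases "i = 0") (auto simp: pl0 lt_le)
  have pl_mono: "le (pl x i) (pl y i)" if "le x y" for x y i
    by (induction i) (use that sc_mono in \<open>auto simp: pl0 plS\<close>)
  define hist where "hist = (\<lambda>(f :: 'i \<Rightarrow> 'i \<times> 'h) \<delta>. restrict (\<lambda>\<epsilon>. snd (f \<epsilon>)) (underS \<delta>))"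
  \<comment> \<open>The innings beyond all blocks of earlier \<epsilon>. Block \<delta> starts at
    the least of them and takes \<open>len\<close> consecutive innings, so blocks are disjoint and
    in order. The recursion carries the start together with the simulated move, because block
    lengths depend on earlier simulated moves.\<close>
  define Bd where "Bd = (\<lambda>(f :: 'i \<Rightarrow> 'i \<times> 'h) \<delta>. {\<gamma> \<in> Field s. \<forall>\<epsilon>\<in>underS \<delta>. \<forall>i<len \<epsilon> (hist f \<epsilon>). lt (pl (fst (f \<epsilon>)) i) \<gamma>})"
  define \<Phi> where "\<Phi> = (\<lambda>A f \<delta>. (minim (Bd f \<delta>), nxt \<delta> (hist f \<delta>) (\<lambda>i. A (pl (minim (Bd f \<delta>)) i))))"
  define F where "F = (\<lambda>A :: 'i \<Rightarrow> 'a. worec (\<Phi> A))"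
  have hist_cong: "hist f \<delta> = hist g \<delta>" if "\<And>\<epsilon>. lt \<epsilon> \<delta> \<Longrightarrow> snd (f \<epsilon>) = snd (g \<epsilon>)" for f g :: "'i \<Rightarrow> 'i \<times> 'h" and \<delta>
    using that by (auto simp: hist_def restrict_def uS)
  have Bd_cong: "Bd f \<delta> = Bd g \<delta>"
    if "\<And>\<epsilon>. lt \<epsilon> \<delta> \<Longrightarrow> fst (f \<epsilon>) = fst (g \<epsilon>) \<and> hist f \<epsilon> = hist g \<epsilon>" for f g :: "'i \<Rightarrow> 'i \<times> 'h" and \<delta>
    using that by (auto simp: Bd_def uS)
  have "adm_wo (\<Phi> A)" for A
    unfolding adm_wo_def
  proof (intro allI impI)
    fix f g :: "'i \<Rightarrow> 'i \<times> 'h" and \<delta> assume eq: "\<forall>y\<in>underS \<delta>. f y = g y"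
    have eq': "f \<epsilon> = g \<epsilon>" if "lt \<epsilon> \<delta>" for \<epsilon> using eq that uS by blast
    have h: "hist f \<epsilon> = hist g \<epsilon>" if "lt \<epsilon> \<delta>" for \<epsilon>
      using that by (intro hist_cong) (metis eq' lt_le lt_le_trans)
    have "hist f \<delta> = hist g \<delta>" using eq' by (intro hist_cong) auto
    moreover have "Bd f \<delta> = Bd g \<delta>" using eq' h by (intro Bd_cong) auto
    ultimately show "\<Phi> A f \<delta> = \<Phi> A g \<delta>" by (simp add: \<Phi>_def)
  qed
  then have F: "F A = \<Phi> A (F A)" for A unfolding F_def by (rule worec_fixpoint)
  define S where "S = (\<lambda>A \<delta>. fst (F A \<delta>))"
  define H where "H = (\<lambda>A \<delta>. snd (F A \<delta>))"
  define N where "N = (\<lambda>A \<delta>. len \<delta> (hist (F A) \<delta>))"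
  have S: "S A \<delta> = minim (Bd (F A) \<delta>)" for A \<delta>
    unfolding S_def by (subst F) (simp add: \<Phi>_def)
  have hist: "hist (F A) \<delta> = restrict (H A) (underS \<delta>)" for A \<delta>
    by (simp add: hist_def H_def)
  have H: "H A \<delta> = nxt \<delta> (hist (F A) \<delta>) (\<lambda>i. A (pl (S A \<delta>) i))" for A \<delta>
    unfolding H_def S by (subst F) (simp add: \<Phi>_def)
  have Bd: "\<gamma> \<in> Bd (F A) \<delta> \<longleftrightarrow> \<gamma> \<in> Field s \<and> (\<forall>\<epsilon>. lt \<epsilon> \<delta> \<longrightarrow> (\<forall>i<N A \<epsilon>. lt (pl (S A \<epsilon>) i) \<gamma>))" for A \<gamma> \<delta>
    by (auto simp: Bd_def uS N_def S_def)
  have start: "\<delta> \<in> Field s \<longrightarrow> S A \<delta> \<in> Bd (F A) \<delta> \<and> (\<exists>j. le (S A \<delta>) (pl \<delta> j))" for A \<delta>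
  proof (induction \<delta> rule: well_order_induct)
    case (1 \<delta>)
    have IH: "S A \<epsilon> \<in> Bd (F A) \<epsilon> \<and> (\<exists>j. le (S A \<epsilon>) (pl \<epsilon> j))" if "lt \<epsilon> \<delta>" for \<epsilon>
      using 1 that ltF[OF that] by (auto simp: lt_def)
    show ?case
    proof
      assume \<delta>: "\<delta> \<in> Field s"
      have "\<exists>b j. b \<in> Bd (F A) \<delta> \<and> le b (pl \<delta> j)"
      proof (cases "\<exists>\<epsilon>. lt \<epsilon> \<delta> \<and> sc \<epsilon> = \<delta>")
        case True
        then obtain \<epsilon> where \<epsilon>: "lt \<epsilon> \<delta>" "sc \<epsilon> = \<delta>" by blast
        obtain j where j: "le (S A \<epsilon>) (pl \<epsilon> j)" using IH[OF \<epsilon>(1)] by blast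
        have SF: "S A \<epsilon> \<in> Field s" using IH[OF \<epsilon>(1)] by (simp add: Bd)
        \<comment> \<open>The first inning after block \<epsilon>; blocks before it end even before
          block \<epsilon> starts.\<close>
        let ?b = "pl (S A \<epsilon>) (N A \<epsilon>)"
        have "lt (pl (S A \<epsilon>') i) ?b" if \<epsilon>': "lt \<epsilon>' \<delta>" and i: "i < N A \<epsilon>'" for \<epsilon>' i
        proof (cases "\<epsilon>' = \<epsilon>")
          case True
          then show ?thesis using pl_lt[OF SF] i by simp
        next
          case False
          have "\<not> lt \<epsilon> \<epsilon>'"
            using sc(2)[of \<epsilon> \<epsilon>'] \<epsilon> \<epsilon>' lt_le_trans lt_irrefl ltF by blast
          then have "lt \<epsilon>' \<epsilon>" using lin[of \<epsilon> \<epsilon>'] False \<epsilon> \<epsilon>' ltF by blast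
          then have "lt (pl (S A \<epsilon>') i) (S A \<epsilon>)" using IH[OF \<epsilon>(1)] i by (simp add: Bd)
          then show ?thesis using pl_ge[OF SF] by (rule lt_le_trans)
        qed
        then have "?b \<in> Bd (F A) \<delta>" using plF[OF SF] by (simp add: Bd)
        moreover have "le ?b (pl \<delta> (j + N A \<epsilon>))"
        proof -
          have "le ?b (pl \<epsilon> (j + N A \<epsilon>))" using pl_mono[OF j, of "N A \<epsilon>"] by (simp add: pl_add)
          then show ?thesis using pl_mono[OF lt_le[OF \<epsilon>(1)]] by (rule le_trans)
        qed
        ultimately show ?thesis by blast
      next
        \<comment> \<open>Now \<delta> is a limit or the least element. A block that starts finitely
          far after some \<epsilon> below \<delta> also ends below \<delta>, so \<delta> itself is
          available as a start.\<close>
        case False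
        have "lt (sc \<epsilon>) \<delta>" if "lt \<epsilon> \<delta>" for \<epsilon>
          using sc(2)[of \<epsilon> \<delta>] that False ltF[OF that] by (auto simp: lt_def le_def)
        then have fin: "lt (pl \<epsilon> k) \<delta>" if "lt \<epsilon> \<delta>" for \<epsilon> k
          by (induction k) (use that in \<open>auto simp: pl0 plS\<close>)
        have "lt (pl (S A \<epsilon>) i) \<delta>" if \<epsilon>: "lt \<epsilon> \<delta>" for \<epsilon> i
        proof -
          obtain j where "le (S A \<epsilon>) (pl \<epsilon> j)" using IH[OF \<epsilon>] by blast
          then have "le (pl (S A \<epsilon>) i) (pl \<epsilon> (j + i))" using pl_mono[of _ _ i] by (metis pl_add)
          then show ?thesis using fin[OF \<epsilon>] by (rule le_lt_trans)
        qed
        then have "\<delta> \<in> Bd (F A) \<delta>" using \<delta> by (simp add: Bd)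
        then show ?thesis using le_refl[OF \<delta>] by (metis pl0)
      qed
      then obtain b j where b: "b \<in> Bd (F A) \<delta>" "le b (pl \<delta> j)" by blast
      have sub: "Bd (F A) \<delta> \<subseteq> Field s" by (auto simp: Bd)
      have "le (S A \<delta>) b" unfolding S le_def by (rule minim_least[OF sub b(1)])
      then have "le (S A \<delta>) (pl \<delta> j)" using b(2) by (rule le_trans)
      moreover have "S A \<delta> \<in> Bd (F A) \<delta>" unfolding S using minim_in[OF sub] b(1) by blast
      ultimately show "S A \<delta> \<in> Bd (F A) \<delta> \<and> (\<exists>j. le (S A \<delta>) (pl \<delta> j))" by blast
    qed
  qed
  have SF: "S A \<delta> \<in> Field s" if "\<delta> \<in> Field s" for A \<delta> using start[of \<delta> A] that by (simp add: Bd)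
  have S_lt: "lt (pl (S A \<epsilon>) i) (S A \<delta>)" if "lt \<epsilon> \<delta>" "i < N A \<epsilon>" for A \<epsilon> \<delta> i
    using start[of \<delta> A] that ltF[OF that(1)] by (simp add: Bd)
  \<comment> \<open>Agreement is claimed for the start and the history of block \<delta>, not for
    \<open>H A \<delta>\<close>: the block may run past \<gamma>, where the two plays can
    differ.\<close>
  have causal: "\<delta> \<in> Field s \<longrightarrow> le (S A \<delta>) \<gamma> \<longrightarrow> S B \<delta> = S A \<delta> \<and> hist (F B) \<delta> = hist (F A) \<delta>"
    if AB: "\<And>x. le x \<gamma> \<Longrightarrow> A x = B x" for A B \<gamma> \<delta>
  proof (induction \<delta> rule: well_order_induct)
    case (1 \<delta>)
    show ?case
    proof (intro impI)
      assume \<delta>: "\<delta> \<in> Field s" "le (S A \<delta>) \<gamma>"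
      have IH: "S B \<epsilon> = S A \<epsilon>" "hist (F B) \<epsilon> = hist (F A) \<epsilon>" if \<epsilon>: "lt \<epsilon> \<delta>" for \<epsilon>
      proof -
        \<comment> \<open>Index 0 belongs to block \<epsilon> because \<open>len\<close> is
          positive; an empty block would not force the next start to be later.\<close>
        have "lt (S A \<epsilon>) (S A \<delta>)" using S_lt[OF \<epsilon>, of 0 A] len by (simp add: pl0 N_def)
        then have "le (S A \<epsilon>) \<gamma>" using \<delta>(2) lt_le le_trans by blast
        then show "S B \<epsilon> = S A \<epsilon>" "hist (F B) \<epsilon> = hist (F A) \<epsilon>"
          using 1 \<epsilon> ltF[OF \<epsilon>] by (auto simp: lt_def)
      qed
      have "H B \<epsilon> = H A \<epsilon>" if \<epsilon>: "lt \<epsilon> \<delta>" for \<epsilon>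
        unfolding H IH[OF \<epsilon>]
      proof (rule nxt)
        fix i assume "i < len \<epsilon> (hist (F A) \<epsilon>)"
        then have "lt (pl (S A \<epsilon>) i) (S A \<delta>)" using S_lt[OF \<epsilon>] by (simp add: N_def)
        then show "B (pl (S A \<epsilon>) i) = A (pl (S A \<epsilon>) i)"
          using \<delta>(2) lt_le le_trans AB by metis
      qed
      then have "hist (F B) \<delta> = hist (F A) \<delta>" by (intro hist_cong) (simp add: H_def)
      moreover have "Bd (F B) \<delta> = Bd (F A) \<delta>"
        using IH by (intro Bd_cong) (simp add: S_def)
      ultimately show "S B \<delta> = S A \<delta> \<and> hist (F B) \<delta> = hist (F A) \<delta>" by (simp add: S)
    qed
  qed
  show ?thesis
  proof (rule that[of H "\<lambda>A \<delta> i. pl (S A \<delta>) i"])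
    show "H A \<delta> = nxt \<delta> (restrict (H A) (underS \<delta>)) (\<lambda>i. A (pl (S A \<delta>) i))" for A \<delta>
      using H[of A \<delta>] by (simp add: hist)
    show "pl (S A \<delta>) i \<in> Field s" if "\<delta> \<in> Field s" for A \<delta> i
      using plF SF that by blast
  next
    fix A \<delta> \<epsilon> i j
    assume F: "\<delta> \<in> Field s" "\<epsilon> \<in> Field s" and i: "i < len \<delta> (restrict (H A) (underS \<delta>))"
      and j: "j < len \<epsilon> (restrict (H A) (underS \<epsilon>))" and eq: "pl (S A \<delta>) i = pl (S A \<epsilon>) j"
    have ij: "i < N A \<delta>" "j < N A \<epsilon>" using i j by (simp_all add: N_def hist)
    have "\<not> lt \<delta> \<epsilon>"
      using S_lt[of \<delta> \<epsilon> i A] ij pl_ge[OF SF[OF F(2)], of A j] eq lt_le_trans lt_irrefl by metis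
    moreover have "\<not> lt \<epsilon> \<delta>"
      using S_lt[of \<epsilon> \<delta> j A] ij pl_ge[OF SF[OF F(1)], of A i] eq lt_le_trans lt_irrefl by metis
    ultimately have "\<delta> = \<epsilon>" using lin[OF F] by blast
    moreover have "i = j"
      using pl_lt[OF SF[OF F(1)], of i j A] pl_lt[OF SF[OF F(1)], of j i A] eq \<open>\<delta> = \<epsilon>\<close> lt_irrefl
      by (cases i j rule: linorder_cases) auto
    ultimately show "\<delta> = \<epsilon> \<and> i = j" ..
  next
    fix A B :: "'i \<Rightarrow> 'a" and \<delta> i
    assume \<delta>: "\<delta> \<in> Field s" and eq: "\<And>x. x \<in> under (pl (S A \<delta>) i) \<Longrightarrow> A x = B x"
    have "S B \<delta> = S A \<delta> \<and> hist (F B) \<delta> = hist (F A) \<delta>"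
      using causal[of "pl (S A \<delta>) i" A B \<delta>] \<delta> eq pl_ge[OF SF[OF \<delta>]] by (auto simp: under_def le_def)
    then show "pl (S B \<delta>) i = pl (S A \<delta>) i \<and> restrict (H B) (underS \<delta>) = restrict (H A) (underS \<delta>)"
      by (simp add: hist)
  qed
qed

section \<open>Games\<close>

lemma finite_dimensional_empty:
  assumes "topspace X = {}"
  shows "finite_dimensional X"
  unfolding finite_dimensional_def covering_dim_le_def
  by (intro exI ballI impI bexI[of _ "{}"]) (use assms in \<open>auto simp: open_covers_def refines_def\<close>)

lemma finite_dimensional_singleton:
  assumes "x \<in> topspace X"
  shows "finite_dimensional (subtopology X {x})"
proof -
  have top: "topspace (subtopology X {x}) = {x}" using assms by auto
  have "covering_dim_le (subtopology X {x}) 0"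
    unfolding covering_dim_le_def
  proof (intro ballI impI)
    fix \<U> assume \<U>: "\<U> \<in> open_covers (subtopology X {x})"
    then obtain U where "U \<in> \<U>" "x \<in> U" unfolding open_covers_def top by blast
    then have "refines {{x}} \<U>" by (auto simp: refines_def)
    moreover have "openin (subtopology X {x}) {x}"
      using openin_topspace[of "subtopology X {x}"] unfolding top .
    then have "{{x}} \<in> open_covers (subtopology X {x})"
      unfolding open_covers_def top by simp
    moreover have "card {V \<in> {{x}}. y \<in> V} \<le> 0 + 1" for y
      using card_mono[of "{{x}}" "{V \<in> {{x}}. y \<in> V}"] by auto
    ultimately show "\<exists>\<V>\<in>open_covers (subtopology X {x}). finite \<V> \<and> refines \<V> \<U> \<and>
        (\<forall>y\<in>topspace (subtopology X {x}). card {V \<in> \<V>. y \<in> V} \<le> 0 + 1)"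
      by (intro bexI[of _ "{{x}}"]) auto
  qed
  then show ?thesis unfolding finite_dimensional_def by blast
qed

lemma S1_strategy_attains_all_open_supersets:
  assumes r: "Well_order r" and \<delta>: "\<delta> \<in> Field r"
    and legal: "\<And>A \<gamma>. (\<forall>\<gamma>\<in>Field r. A \<gamma> \<in> fd_covers X) \<Longrightarrow> \<gamma> \<in> Field r \<Longrightarrow>
      \<sigma> \<gamma> (restrict A (under r \<gamma>)) \<in> A \<gamma>"
    and h: "\<And>\<gamma>. \<gamma> \<in> underS r \<delta> \<Longrightarrow> h \<gamma> \<in> fd_covers X"
  obtains T where "T \<subseteq> topspace X" "finite_dimensional (subtopology X T)"
    "\<And>U. openin X U \<Longrightarrow> T \<subseteq> U \<Longrightarrow> \<exists>A\<in>fd_covers X. \<sigma> \<delta> ((restrict h (underS r \<delta>))(\<delta> := A)) = U"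
proof (rule ccontr)
  let ?FD = "{T. T \<subseteq> topspace X \<and> finite_dimensional (subtopology X T)}"
  let ?resp = "\<lambda>A. \<sigma> \<delta> ((restrict h (underS r \<delta>))(\<delta> := A))"
  note goal = that
  assume no: "\<not> thesis"
  have "\<exists>U. openin X U \<and> T \<subseteq> U \<and> (\<forall>A\<in>fd_covers X. ?resp A \<noteq> U)" if T: "T \<in> ?FD" for T
  proof (rule ccontr)
    assume "\<not> ?thesis"
    then have "\<exists>A\<in>fd_covers X. ?resp A = U" if "openin X U" "T \<subseteq> U" for U using that by auto
    with goal[of T] T have thesis by blast
    with no show False ..
  qed
  then obtain U where U: "\<And>T. T \<in> ?FD \<Longrightarrow> openin X (U T) \<and> T \<subseteq> U T \<and> (\<forall>A\<in>fd_covers X. ?resp A \<noteq> U T)"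
    by metis
  have "topspace X \<subseteq> \<Union>(U ` ?FD)"
  proof
    fix x assume x: "x \<in> topspace X"
    have "{x} \<in> ?FD" using finite_dimensional_singleton[OF x] x by simp
    with U[OF this] show "x \<in> \<Union>(U ` ?FD)" by blast
  qed
  moreover have "\<Union>(U ` ?FD) \<subseteq> topspace X" using U openin_subset by blast
  ultimately have "\<Union>(U ` ?FD) = topspace X" by blast
  moreover have "openin X V" if "V \<in> U ` ?FD" for V using that U by blast
  moreover have "\<exists>V\<in>U ` ?FD. T \<subseteq> V" if "T \<in> ?FD" for T using that U by blast
  ultimately have cov: "U ` ?FD \<in> fd_covers X"
    unfolding fd_covers_def open_covers_def by simp
  \<comment> \<open>The legality of \<sigma> is given for complete plays, so the position is padded:
    from \<delta> on, ONE plays the bad cover throughout.\<close>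
  define A where "A = (\<lambda>\<gamma>. if \<gamma> \<in> underS r \<delta> then h \<gamma> else U ` ?FD)"
  have "(\<delta>, \<delta>) \<in> r"
    using r \<delta> by (metis wo_rel.REFL wo_rel_def refl_on_def)
  then have un: "under r \<delta> = insert \<delta> (underS r \<delta>)" and ni: "\<delta> \<notin> underS r \<delta>"
    by (auto simp: under_def underS_def)
  have "restrict A (under r \<delta>) = (restrict h (underS r \<delta>))(\<delta> := U ` ?FD)"
    unfolding un using ni by (auto simp: restrict_def A_def fun_eq_iff)
  moreover have "\<sigma> \<delta> (restrict A (under r \<delta>)) \<in> A \<delta>"
    by (rule legal[OF _ \<delta>]) (use h cov in \<open>auto simp: A_def\<close>)
  ultimately have "?resp (U ` ?FD) \<in> U ` ?FD" using ni by (simp add: A_def)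
  then show False using U cov by blast
qed

text \<open>Both games run along the same \<open>s\<close>, but out of step: block \<delta> of the
  actual game produces inning \<delta> of the simulated one. TWO never has to wait for a block to be
  complete, since an actual answer requires only the finished blocks and ONE's current
  cover.\<close>

lemma TWO_wins_S1_fd_imp_Sc:
  fixes X :: "'a topology" and s :: "'i rel"
  assumes X: "metrizable_space X" "separable_space X"
    and lim: "limit_ordinal s" and win: "TWO_wins_S1_fd X s"
  shows "TWO_wins_Sc X s"
proof -
  have wo: "Well_order s" using lim unfolding limit_ordinal_def by blast
  interpret wo_rel s using wo by (simp add: wo_rel_def)
  let ?M = "fd_covers X"
  obtain \<sigma> where \<sigma>: "\<And>A. \<forall>\<gamma>\<in>Field s. A \<gamma> \<in> ?M \<Longrightarrow>
      (\<forall>\<gamma>\<in>Field s. \<sigma> \<gamma> (restrict A (under \<gamma>)) \<in> A \<gamma>) \<and>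
      (\<lambda>\<gamma>. \<sigma> \<gamma> (restrict A (under \<gamma>))) ` Field s \<in> open_covers X"
    using win unfolding TWO_wins_S1_fd_def TWO_has_winning_strategy_def by blast
  define good where "good = (\<lambda>\<delta> h zs. zs \<noteq> [] \<and> (\<forall>Z\<in>set zs. zero_dimensional_in X Z) \<and>
      (\<delta> \<in> Field s \<and> (\<forall>\<gamma>\<in>underS \<delta>. h \<gamma> \<in> ?M) \<longrightarrow> (\<forall>U. openin X U \<and> \<Union>(set zs) \<subseteq> U \<longrightarrow>
        (\<exists>A\<in>?M. \<sigma> \<delta> ((restrict h (underS \<delta>))(\<delta> := A)) = U))))"
  have "\<exists>zs. good \<delta> h zs" for \<delta> h
  proof (cases "\<delta> \<in> Field s \<and> (\<forall>\<gamma>\<in>underS \<delta>. h \<gamma> \<in> ?M)")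
    case True
    obtain T where T: "T \<subseteq> topspace X" "finite_dimensional (subtopology X T)"
      "\<And>U. openin X U \<Longrightarrow> T \<subseteq> U \<Longrightarrow> \<exists>A\<in>?M. \<sigma> \<delta> ((restrict h (underS \<delta>))(\<delta> := A)) = U"
      by (rule S1_strategy_attains_all_open_supersets[OF wo, of \<delta> X \<sigma> h]) (use True \<sigma> in blast)+
    obtain zs where "zs \<noteq> []" "T = \<Union>(set zs)" "\<And>Z. Z \<in> set zs \<Longrightarrow> zero_dimensional_in X Z"
      by (rule finite_dimensional_imp_zero_dimensional_pieces[OF X T(1,2)]) blast
    with T(3) have "good \<delta> h zs" by (simp add: good_def)
    then show ?thesis by blast
  next
    case False
    \<comment> \<open>A placeholder for positions outside the game or with an illegal past: the
      blocks are built for arbitrary histories and need a nonempty list at each.\<close>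
    have "zero_dimensional_in X {}"
      unfolding zero_dimensional_in_def by (auto intro!: exI[of _ "{}"] simp: refines_def)
    with False have "good \<delta> h [{}]" unfolding good_def by auto
    then show ?thesis by blast
  qed
  then obtain zs where good: "\<And>\<delta> h. good \<delta> h (zs \<delta> h)" by metis
  have zs_ne: "zs \<delta> h \<noteq> []" and zs_zd: "Z \<in> set (zs \<delta> h) \<Longrightarrow> zero_dimensional_in X Z" for \<delta> h Z
    using good[of \<delta> h] by (auto simp: good_def)
  have zs_nth: "zero_dimensional_in X (zs \<delta> h ! i)" if "i < length (zs \<delta> h)" for \<delta> h i
    using that by (intro zs_zd[of _ \<delta> h] nth_mem)
  have zs_resp: "\<exists>A\<in>?M. \<sigma> \<delta> ((restrict h (underS \<delta>))(\<delta> := A)) = U"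
    if "\<delta> \<in> Field s" "\<And>\<gamma>. \<gamma> \<in> underS \<delta> \<Longrightarrow> h \<gamma> \<in> ?M" "openin X U" "\<Union>(set (zs \<delta> h)) \<subseteq> U" for \<delta> h U
    using good[of \<delta> h] that by (simp add: good_def)
  define picks where "picks = (\<lambda>Z \<A> \<B>. (\<forall>B\<in>\<B>. openin X B) \<and> pairwise disjnt \<B> \<and> refines \<B> \<A> \<and> Z \<subseteq> \<Union>\<B>)"
  define bb where "bb = (\<lambda>Z \<A>. SOME \<B>. picks Z \<A> \<B>)"
  have bb: "(\<forall>B\<in>bb Z \<A>. openin X B) \<and> pairwise disjnt (bb Z \<A>) \<and> refines (bb Z \<A>) \<A> \<and> Z \<subseteq> \<Union>(bb Z \<A>)"
    if "\<A> \<in> open_covers X" "zero_dimensional_in X Z" for Z \<A>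
  proof -
    have "\<exists>\<B>. picks Z \<A> \<B>"
      using that unfolding zero_dimensional_in_def picks_def by (rule bspec[rotated])
    then have "picks Z \<A> (bb Z \<A>)" unfolding bb_def by (rule someI_ex)
    then show ?thesis unfolding picks_def .
  qed
  define len where "len = (\<lambda>\<delta> h. length (zs \<delta> h))"
  define out where "out = (\<lambda>\<delta> h a. \<Union>i<len \<delta> h. \<Union>(bb (zs \<delta> h ! i) (a i)))"
  \<comment> \<open>The choice in hindsight. Given the history, it sees ONE's covers in the block
    only through \<open>out\<close>, the union of TWO's answers there.\<close>
  define nxt where "nxt = (\<lambda>\<delta> h a. SOME A. A \<in> ?M \<and> \<sigma> \<delta> ((restrict h (underS \<delta>))(\<delta> := A)) = out \<delta> h a)"
  have len0: "0 < len \<delta> h" for \<delta> h using zs_ne[of \<delta> h] by (simp add: len_def)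
  have nxt_cong: "nxt \<delta> h a = nxt \<delta> h b" if "\<And>i. i < len \<delta> h \<Longrightarrow> a i = b i" for \<delta> h a b
  proof -
    have "out \<delta> h a = out \<delta> h b" using that by (simp add: out_def)
    then show ?thesis by (simp add: nxt_def)
  qed
  obtain H st
    where H: "\<And>A \<delta>. H A \<delta> = nxt \<delta> (restrict (H A) (underS \<delta>)) (\<lambda>i. A (st A \<delta> i))"
    and stF: "\<And>A \<delta> i. \<delta> \<in> Field s \<Longrightarrow> st A \<delta> i \<in> Field s"
    and inj: "\<And>A \<delta> \<epsilon> i j. \<delta> \<in> Field s \<Longrightarrow> \<epsilon> \<in> Field s \<Longrightarrow> i < len \<delta> (restrict (H A) (underS \<delta>)) \<Longrightarrow>
       j < len \<epsilon> (restrict (H A) (underS \<epsilon>)) \<Longrightarrow> st A \<delta> i = st A \<epsilon> j \<Longrightarrow> \<delta> = \<epsilon> \<and> i = j"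
    and causal: "\<And>A B \<delta> i. \<delta> \<in> Field s \<Longrightarrow> (\<And>x. x \<in> under (st A \<delta> i) \<Longrightarrow> A x = B x) \<Longrightarrow>
       st B \<delta> i = st A \<delta> i \<and> restrict (H B) (underS \<delta>) = restrict (H A) (underS \<delta>)"
    by (rule limit_ordinal_chunks[of s len nxt, OF lim len0 nxt_cong]) blast+
  define hist where "hist = (\<lambda>A \<delta>. restrict (H A) (underS \<delta>))"
  \<comment> \<open>The pair \<open>p\<close> names a block and a place in it that fall on inning
    \<gamma>. By \<open>inj\<close> there is at most one such pair; an inning in no block is
    answered by the empty family, which is always legal.\<close>
  define active where "active = (\<lambda>A \<gamma> p. fst p \<in> Field s \<and> snd p < len (fst p) (hist A (fst p)) \<and> st A (fst p) (snd p) = \<gamma>)"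
  define \<tau> where "\<tau> = (\<lambda>\<gamma> A. if \<exists>p. active A \<gamma> p
     then (let p = SOME p. active A \<gamma> p in bb (zs (fst p) (hist A (fst p)) ! snd p) (A \<gamma>)) else {})"
  have own: "restrict A (under \<gamma>) \<gamma> = A \<gamma>" if "\<gamma> \<in> Field s" for A :: "'i \<Rightarrow> 'a set set" and \<gamma>
    using REFL that by (auto simp: under_def refl_on_def)
  have \<tau>_at: "\<tau> (st A \<delta> i) (restrict A (under (st A \<delta> i))) = bb (zs \<delta> (hist A \<delta>) ! i) (A (st A \<delta> i))"
    if \<delta>: "\<delta> \<in> Field s" and i: "i < len \<delta> (hist A \<delta>)" for A \<delta> i
  proof -
    let ?\<gamma> = "st A \<delta> i"
    let ?B = "restrict A (under ?\<gamma>)"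
    \<comment> \<open>The strategy sees only the truncated play \<open>?B\<close>. By
      \<open>causal\<close>, the simulation run on \<open>?B\<close> has the same start and history
      of block \<delta> as the one run on \<open>A\<close>.\<close>
    have B: "st ?B \<delta> i = ?\<gamma>" "hist ?B \<delta> = hist A \<delta>"
      using causal[OF \<delta>, of A i ?B] by (auto simp: hist_def)
    then have act: "active ?B ?\<gamma> (\<delta>, i)" using \<delta> i by (simp add: active_def)
    have "p = (\<delta>, i)" if p: "active ?B ?\<gamma> p" for p
    proof -
      have "fst p = \<delta> \<and> snd p = i"
        by (rule inj[of _ _ _ ?B]) (use p act in \<open>simp_all add: active_def hist_def\<close>)
      then show ?thesis by (simp add: prod_eq_iff)
    qed
    then have some: "(SOME p. active ?B ?\<gamma> p) = (\<delta>, i)" by (rule some_equality[where P = "active ?B ?\<gamma>", OF act])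
    have "\<exists>p. active ?B ?\<gamma> p" using act by blast
    then have "\<tau> ?\<gamma> ?B = bb (zs \<delta> (hist ?B \<delta>) ! i) (?B ?\<gamma>)"
      unfolding \<tau>_def Let_def some by simp
    then show ?thesis unfolding B(2) own[OF stF[OF \<delta>]] .
  qed
  have \<tau>_bb: "\<tau> \<gamma> (restrict A (under \<gamma>)) = {} \<or>
      (\<exists>Z. zero_dimensional_in X Z \<and> \<tau> \<gamma> (restrict A (under \<gamma>)) = bb Z (A \<gamma>))"
    if \<gamma>: "\<gamma> \<in> Field s" for A \<gamma>
  proof (cases "\<exists>p. active (restrict A (under \<gamma>)) \<gamma> p")
    case True
    define p where "p = (SOME p. active (restrict A (under \<gamma>)) \<gamma> p)"
    have "active (restrict A (under \<gamma>)) \<gamma> p" unfolding p_def using True by (rule someI_ex)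
    then have "zero_dimensional_in X (zs (fst p) (hist (restrict A (under \<gamma>)) (fst p)) ! snd p)"
      by (intro zs_nth) (simp add: active_def len_def)
    moreover have "\<tau> \<gamma> (restrict A (under \<gamma>)) =
        bb (zs (fst p) (hist (restrict A (under \<gamma>)) (fst p)) ! snd p) (A \<gamma>)"
      using True own[OF \<gamma>, of A] by (simp add: \<tau>_def Let_def p_def)
    ultimately show ?thesis by blast
  next
    case False
    then show ?thesis by (simp add: \<tau>_def)
  qed
  show ?thesis
    unfolding TWO_wins_Sc_def TWO_has_winning_strategy_def
  proof (intro exI[of _ \<tau>] allI impI conjI ballI)
    fix A \<gamma> assume A: "\<forall>\<gamma>\<in>Field s. A \<gamma> \<in> open_covers X" and \<gamma>: "\<gamma> \<in> Field s"
    show "\<tau> \<gamma> (restrict A (under \<gamma>)) \<in> {\<B>. pairwise disjnt \<B> \<and> refines \<B> (A \<gamma>)}"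
      using \<tau>_bb[OF \<gamma>, of A]
    proof (elim disjE exE conjE)
      fix Z assume "zero_dimensional_in X Z" "\<tau> \<gamma> (restrict A (under \<gamma>)) = bb Z (A \<gamma>)"
      then show ?thesis using bb[OF bspec[OF A \<gamma>]] by simp
    qed (simp add: refines_def)
  next
    fix A assume A: "\<forall>\<gamma>\<in>Field s. A \<gamma> \<in> open_covers X"
    let ?R = "\<lambda>\<gamma>. \<tau> \<gamma> (restrict A (under \<gamma>))"
    have open_R: "openin X B" if \<gamma>: "\<gamma> \<in> Field s" and B: "B \<in> ?R \<gamma>" for \<gamma> B
      using \<tau>_bb[OF \<gamma>, of A]
    proof (elim disjE exE conjE)
      fix Z assume "zero_dimensional_in X Z" "?R \<gamma> = bb Z (A \<gamma>)"
      then show ?thesis using bb[OF bspec[OF A \<gamma>]] B by simp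
    qed (use B in simp)
    let ?out = "\<lambda>\<delta>. out \<delta> (hist A \<delta>) (\<lambda>i. A (st A \<delta> i))"
    have bb_st: "(\<forall>B\<in>bb (zs \<delta> (hist A \<delta>) ! i) (A (st A \<delta> i)). openin X B) \<and>
        zs \<delta> (hist A \<delta>) ! i \<subseteq> \<Union>(bb (zs \<delta> (hist A \<delta>) ! i) (A (st A \<delta> i)))"
      if "\<delta> \<in> Field s" "i < len \<delta> (hist A \<delta>)" for \<delta> i
    proof -
      have "zero_dimensional_in X (zs \<delta> (hist A \<delta>) ! i)"
        using that(2) by (intro zs_nth) (simp add: len_def)
      from bb[OF bspec[OF A stF[OF that(1)]] this] show ?thesis by simp
    qed
    \<comment> \<open>The choice made by \<open>nxt\<close> is meaningful at \<delta> only if the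
      simulated past is legal, for only then is \<open>out\<close> known to be an answer of
      \<sigma>; hence the induction.\<close>
    have H_legal: "\<delta> \<in> Field s \<longrightarrow> H A \<delta> \<in> ?M \<and> \<sigma> \<delta> (restrict (H A) (under \<delta>)) = ?out \<delta>" for \<delta>
    proof (induction \<delta> rule: well_order_induct)
      case (1 \<delta>)
      show ?case
      proof
        assume \<delta>: "\<delta> \<in> Field s"
        have legal: "hist A \<delta> \<gamma> \<in> ?M" if "\<gamma> \<in> underS \<delta>" for \<gamma>
          using 1 that by (auto simp: hist_def underS_def intro: FieldI1)
        have op: "openin X (?out \<delta>)"
          unfolding out_def using bb_st[OF \<delta>] by (intro openin_Union) auto
        have "\<Union>(set (zs \<delta> (hist A \<delta>))) \<subseteq> ?out \<delta>"
        proof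
          fix x assume "x \<in> \<Union>(set (zs \<delta> (hist A \<delta>)))"
          then obtain i where i: "i < len \<delta> (hist A \<delta>)" "x \<in> zs \<delta> (hist A \<delta>) ! i"
            by (auto simp: in_set_conv_nth len_def)
          with bb_st[OF \<delta> i(1)] show "x \<in> ?out \<delta>" unfolding out_def by blast
        qed
        from zs_resp[OF \<delta> legal op this]
        have ex: "\<exists>B. B \<in> ?M \<and> \<sigma> \<delta> ((restrict (hist A \<delta>) (underS \<delta>))(\<delta> := B)) = ?out \<delta>"
          by blast
        have HA: "H A \<delta> = (SOME B. B \<in> ?M \<and> \<sigma> \<delta> ((restrict (hist A \<delta>) (underS \<delta>))(\<delta> := B)) = ?out \<delta>)"
          using H[of A \<delta>] unfolding nxt_def hist_def .
        have "H A \<delta> \<in> ?M \<and> \<sigma> \<delta> ((restrict (hist A \<delta>) (underS \<delta>))(\<delta> := H A \<delta>)) = ?out \<delta>"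
          unfolding HA using ex by (rule someI_ex)
        moreover have "(restrict (hist A \<delta>) (underS \<delta>))(\<delta> := H A \<delta>) = restrict (H A) (under \<delta>)"
          using REFL \<delta> by (auto simp: hist_def restrict_def fun_eq_iff under_def underS_def refl_on_def)
        ultimately show "H A \<delta> \<in> ?M \<and> \<sigma> \<delta> (restrict (H A) (under \<delta>)) = ?out \<delta>" by simp
      qed
    qed
    \<comment> \<open>With the simulated play complete and legal, \<sigma> wins it, so the unions of
      the blocks cover \<open>X\<close>.\<close>
    have "\<forall>\<delta>\<in>Field s. H A \<delta> \<in> ?M" using H_legal by blast
    from \<sigma>[OF this] have "(\<Union>\<delta>\<in>Field s. \<sigma> \<delta> (restrict (H A) (under \<delta>))) = topspace X"
      unfolding open_covers_def by simp
    moreover have "(\<Union>\<delta>\<in>Field s. \<sigma> \<delta> (restrict (H A) (under \<delta>))) = (\<Union>\<delta>\<in>Field s. ?out \<delta>)"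
      by (rule SUP_cong) (use H_legal in auto)
    ultimately have cov: "topspace X = (\<Union>\<delta>\<in>Field s. ?out \<delta>)" by simp
    have sup: "topspace X \<subseteq> \<Union>(\<Union>(?R ` Field s))"
    proof
      fix x assume "x \<in> topspace X"
      then obtain \<delta> where \<delta>: "\<delta> \<in> Field s" "x \<in> ?out \<delta>" using cov by blast
      then obtain i where i: "i < len \<delta> (hist A \<delta>)" "x \<in> \<Union>(bb (zs \<delta> (hist A \<delta>) ! i) (A (st A \<delta> i)))"
        unfolding out_def by blast
      then have "x \<in> \<Union>(?R (st A \<delta> i))" using \<tau>_at[OF \<delta>(1) i(1)] by simp
      with stF[OF \<delta>(1)] show "x \<in> \<Union>(\<Union>(?R ` Field s))" by blast
    qed
    have op: "openin X B" if "B \<in> \<Union>(?R ` Field s)" for B using that open_R by blast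
    then have "\<Union>(\<Union>(?R ` Field s)) \<subseteq> topspace X" by (intro Union_least openin_subset)
    with sup op show "\<Union>(?R ` Field s) \<in> open_covers X"
      unfolding open_covers_def by (intro CollectI conjI ballI equalityI)
  qed
qed

text \<open>The first \<open>r\<close> innings already produce a cover, and further open sets do no
  harm, so any legal answer will do in the appended innings.\<close>

lemma TWO_wins_S1_fd_ord_sum:
  fixes r :: "'i rel" and s :: "'j rel"
  assumes "Well_order r" "Well_order s" "TWO_wins_S1_fd X r"
  shows "TWO_wins_S1_fd X (r \<oplus>o s)"
proof -
  obtain \<sigma> where \<sigma>: "\<And>A. \<forall>\<gamma>\<in>Field r. A \<gamma> \<in> fd_covers X \<Longrightarrow>
      (\<forall>\<gamma>\<in>Field r. \<sigma> \<gamma> (restrict A (under r \<gamma>)) \<in> A \<gamma>) \<and>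
      (\<lambda>\<gamma>. \<sigma> \<gamma> (restrict A (under r \<gamma>))) ` Field r \<in> open_covers X"
    using assms(3) unfolding TWO_wins_S1_fd_def TWO_has_winning_strategy_def by blast
  define \<tau> where "\<tau> = (\<lambda>(\<gamma> :: 'i + 'j) A. case \<gamma> of
      Inl a \<Rightarrow> \<sigma> a (restrict (\<lambda>b. A (Inl b)) (under r a)) | Inr c \<Rightarrow> SOME U. U \<in> A (Inr c))"
  show ?thesis
    unfolding TWO_wins_S1_fd_def TWO_has_winning_strategy_def
  proof (intro exI[of _ \<tau>] allI impI)
    fix A assume A: "\<forall>\<gamma>\<in>Field (r \<oplus>o s). A \<gamma> \<in> fd_covers X"
    then have Al: "\<forall>a\<in>Field r. A (Inl a) \<in> fd_covers X" and Ar: "\<forall>c\<in>Field s. A (Inr c) \<in> fd_covers X"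
      by (auto simp: Field_ord_sum)
    let ?R = "\<lambda>\<gamma>. \<tau> \<gamma> (restrict A (under (r \<oplus>o s) \<gamma>))"
    have l: "?R (Inl a) = \<sigma> a (restrict (\<lambda>b. A (Inl b)) (under r a))" for a
    proof -
      have "restrict (\<lambda>b. restrict A (under (r \<oplus>o s) (Inl a)) (Inl b)) (under r a) =
          restrict (\<lambda>b. A (Inl b)) (under r a)"
        by (auto simp: restrict_def under_def fun_eq_iff)
      then show ?thesis by (simp add: \<tau>_def)
    qed
    have r: "?R (Inr c) \<in> A (Inr c)" if c: "c \<in> Field s" for c
    proof -
      have "(c, c) \<in> s" using assms(2) c by (metis wo_rel.REFL wo_rel_def refl_on_def)
      then have R: "?R (Inr c) = (SOME U. U \<in> A (Inr c))" by (simp add: \<tau>_def under_def)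
      \<comment> \<open>Some member of ONE's cover contains the empty set, so there is something to
        choose even if \<open>X\<close> has no points.\<close>
      have "finite_dimensional (subtopology X {})" by (rule finite_dimensional_empty) simp
      then have "\<exists>U. U \<in> A (Inr c)" using bspec[OF Ar c] unfolding fd_covers_def by blast
      then show ?thesis unfolding R by (rule someI_ex)
    qed
    note w = \<sigma>[OF Al]
    have legal: "?R \<gamma> \<in> A \<gamma>" if "\<gamma> \<in> Field (r \<oplus>o s)" for \<gamma>
      using that w r l by (auto simp: Field_ord_sum)
    have "openin X U" if "U \<in> ?R ` Field (r \<oplus>o s)" for U
      using that legal A unfolding fd_covers_def open_covers_def by auto
    moreover have "topspace X \<subseteq> \<Union>(?R ` Field (r \<oplus>o s))"
    proof
      fix x assume "x \<in> topspace X"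
      also have "topspace X = (\<Union>\<gamma>\<in>Field r. \<sigma> \<gamma> (restrict (\<lambda>b. A (Inl b)) (under r \<gamma>)))"
        using w unfolding open_covers_def by auto
      finally obtain a where "a \<in> Field r" "x \<in> \<sigma> a (restrict (\<lambda>b. A (Inl b)) (under r a))"
        by blast
      then show "x \<in> \<Union>(?R ` Field (r \<oplus>o s))"
        unfolding l[symmetric] Field_ord_sum by blast
    qed
    ultimately have "?R ` Field (r \<oplus>o s) \<in> open_covers X"
      unfolding open_covers_def by (auto dest: openin_subset)
    with legal show "(\<forall>\<gamma>\<in>Field (r \<oplus>o s). ?R \<gamma> \<in> A \<gamma>) \<and> ?R ` Field (r \<oplus>o s) \<in> open_covers X"
      by blast
  qed
qed

section \<open>Bounds for the game dimension\<close>

lemma dim_G_ordLeq_limit: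
  fixes X :: "'a topology" and s :: "'i rel"
  assumes X: "metrizable_space X" "separable_space X" "topspace X \<noteq> {}"
    and "limit_ordinal s" "TWO_wins_S1_fd X s"
  shows "dim_G X \<le>o s"
proof -
  have wo: "Well_order s" using assms(4) unfolding limit_ordinal_def by blast
  have "Well_order ord_one"
    by (auto simp: ord_one_def well_order_on_def linear_order_on_def partial_order_on_def
        preorder_on_def refl_on_def trans_def antisym_def total_on_def Field_def)
  \<comment> \<open>The 1 stands on the left, so \<open>dim_G X\<close> is a final part of
    \<open>tp_Sc X\<close> and cannot be longer.\<close>
  then have "dim_G X \<le>o ord_one \<oplus>o dim_G X"
    using dim_G_works(1)[OF X(3)] by (rule ord_sum_ordLeq_left)
  also have "ord_one \<oplus>o dim_G X =o tp_Sc X" by (rule dim_G_works(2)[OF X(3)])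
  also have "tp_Sc X \<le>o s"
    by (rule tp_Sc_works(3)[OF wo TWO_wins_S1_fd_imp_Sc[OF X(1,2) assms(4,5)]])
  finally show ?thesis .
qed

theorem theorem27:
  fixes X :: "'a topology"
  assumes "metrizable_space X" and "separable_space X"
    and "\<not> finite_dimensional X"
  shows "(limit_ordinal (tp_S1_fd X) \<longrightarrow> dim_G X \<le>o tp_S1_fd X) \<and>
         (\<not> limit_ordinal (tp_S1_fd X) \<longrightarrow> dim_G X \<le>o tp_S1_fd X \<oplus>o natLeq)"
proof -
  \<comment> \<open>\<open>dim_G\<close> is determined for nonempty spaces only; the empty space is
    finite dimensional and thus excluded.\<close>
  have ne: "topspace X \<noteq> {}" using assms(3) finite_dimensional_empty by blast
  have "TWO_wins_S1_fd X (tp_S1_fd X \<oplus>o natLeq)"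
    by (rule TWO_wins_S1_fd_ord_sum[OF tp_S1_fd_works(1) natLeq_Well_order tp_S1_fd_works(2)])
  then have "dim_G X \<le>o tp_S1_fd X \<oplus>o natLeq"
    by (rule dim_G_ordLeq_limit[OF assms(1,2) ne limit_ordinal_ord_sum_natLeq[OF tp_S1_fd_works(1)]])
  moreover have "dim_G X \<le>o tp_S1_fd X" if "limit_ordinal (tp_S1_fd X)"
    by (rule dim_G_ordLeq_limit[OF assms(1,2) ne that tp_S1_fd_works(2)])
  ultimately show ?thesis by simp
qed

end
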